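(* Let $\Bbbk$ be a commutative ring and let $A$ be an augmented $\Bbbk$-algebra of finite type. Then $A$ is complete if and only if there exist a finite set $X$ and a closed ideal $\mathfrak a\subseteq I(\Bbbk\langle\!\langle X\rangle\!\rangle)$ such that $A\cong\Bbbk\langle\!\langle X\rangle\!\rangle/\mathfrak a$ (as augmented algebras).
   Context: An augmented algebra is an associative unital $\Bbbk$-algebra $A$ with an algebra homomorphism $\varepsilon_A:A\to\Bbbk$; $I(A)=\ker\varepsilon_A$, and $A$ carries the $I(A)$-adic topology. Morphisms (isomorphisms) commute with augmentations. $A$ is of finite type if $I(A)/I(A)^2$ is a finitely generated $\Bbbk$-module. $\hat A=\varprojlim_nA/I(A)^n$, and $A$ is complete if the natural map $A\to\hat A$ is an isomorphism. $\Bbbk\langle\!\langle X\rangle\!\rangle$ is the algebra of non-commutative formal power series in $X$ with augmentation the constant coefficient; an ideal $\mathfrak a$ in it is closed if it is closed in the $I$-adic topology, i.e. $\mathfrak a=\bigcap_n(\mathfrak a+I^n)$ with $I=I(\Bbbk\langle\!\langle X\rangle\!\rangle)$. *)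

theory Defs
  imports "HOL-Algebra.Module" "HOL-Algebra.QuotRing" "HOL-Algebra.Ideal_Product"
begin

section \<open>Augmented algebras\<close>

record ('k, 'a) aug_algebra = "('k, 'a) module" +
  aug :: "'a \<Rightarrow> 'k"

text \<open>The library locale \<^locale>\<open>algebra\<close> is restricted to commutative algebras.\<close>

locale augmented_algebra = module k A + A?: ring A
  for k :: "('k, 'm) ring_scheme" (structure)
    and A :: "('k, 'a, 'n) aug_algebra_scheme" (structure) +
  assumes smult_mult_left:
      "\<lbrakk>c \<in> carrier k; x \<in> carrier A; y \<in> carrier A\<rbrakk>
        \<Longrightarrow> (c \<odot>\<^bsub>A\<^esub> x) \<otimes>\<^bsub>A\<^esub> y = c \<odot>\<^bsub>A\<^esub> (x \<otimes>\<^bsub>A\<^esub> y)"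
    and smult_mult_right:
      "\<lbrakk>c \<in> carrier k; x \<in> carrier A; y \<in> carrier A\<rbrakk>
        \<Longrightarrow> x \<otimes>\<^bsub>A\<^esub> (c \<odot>\<^bsub>A\<^esub> y) = c \<odot>\<^bsub>A\<^esub> (x \<otimes>\<^bsub>A\<^esub> y)"
    and aug_ring_hom: "aug A \<in> ring_hom A k"
    and aug_smult:
      "\<lbrakk>c \<in> carrier k; x \<in> carrier A\<rbrakk> \<Longrightarrow> aug A (c \<odot>\<^bsub>A\<^esub> x) = c \<otimes>\<^bsub>k\<^esub> aug A x"

definition aug_hom ::
  "('k, 'm) ring_scheme \<Rightarrow> ('k, 'a, 'n) aug_algebra_scheme \<Rightarrow> ('k, 'b, 'p) aug_algebra_scheme
    \<Rightarrow> ('a \<Rightarrow> 'b) set"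
  where "aug_hom k A B =
    {h \<in> ring_hom A B.
      (\<forall>c\<in>carrier k. \<forall>x\<in>carrier A. h (c \<odot>\<^bsub>A\<^esub> x) = c \<odot>\<^bsub>B\<^esub> h x) \<and>
      (\<forall>x\<in>carrier A. aug B (h x) = aug A x)}"

definition aug_iso ::
  "('k, 'm) ring_scheme \<Rightarrow> ('k, 'a, 'n) aug_algebra_scheme \<Rightarrow> ('k, 'b, 'p) aug_algebra_scheme
    \<Rightarrow> ('a \<Rightarrow> 'b) set"
  where "aug_iso k A B = {h \<in> aug_hom k A B. bij_betw h (carrier A) (carrier B)}"

definition aug_isomorphic ::
  "('k, 'm) ring_scheme \<Rightarrow> ('k, 'a, 'n) aug_algebra_scheme \<Rightarrow> ('k, 'b, 'p) aug_algebra_scheme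
    \<Rightarrow> bool"
  where "aug_isomorphic k A B \<longleftrightarrow> aug_iso k A B \<noteq> {}"

definition aug_ideal ::
  "('k, 'm) ring_scheme \<Rightarrow> ('k, 'a, 'n) aug_algebra_scheme \<Rightarrow> 'a set"
  where "aug_ideal k A = a_kernel A k (aug A)"

primrec ideal_power :: "('a, 'm) ring_scheme \<Rightarrow> 'a set \<Rightarrow> nat \<Rightarrow> 'a set"
  where
    "ideal_power R I 0 = carrier R"
  | "ideal_power R I (Suc n) = ideal_prod R (ideal_power R I n) I"


section \<open>Quotients and finite type\<close>

text \<open>As for \<^const>\<open>rcoset_mult\<close>, the operations on cosets are given without choosing
  representatives. If \<open>N\<close> is a submodule, \<open>c\<close> acts by \<open>N + x \<mapsto> N + c x\<close>; if \<open>J\<close> is contained in the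
  augmentation ideal, the augmentation is constant on each coset of \<open>J\<close>. When \<open>M\<close> is merely a
  module, the multiplicative fields of \<open>quot_module M N\<close> carry no information.\<close>

definition quot_module :: "('k, 'a, 'n) module_scheme \<Rightarrow> 'a set \<Rightarrow> ('k, 'a set) module"
  where "quot_module M N =
    \<lparr>carrier = carrier (M Quot N), mult = mult (M Quot N), one = one (M Quot N),
     zero = zero (M Quot N), add = add (M Quot N),
     smult = (\<lambda>c C. \<Union>x\<in>C. N +>\<^bsub>M\<^esub> (c \<odot>\<^bsub>M\<^esub> x))\<rparr>"

definition quot_aug_algebra ::
  "('k, 'a, 'n) aug_algebra_scheme \<Rightarrow> 'a set \<Rightarrow> ('k, 'a set) aug_algebra"
  where "quot_aug_algebra A J =
    \<lparr>carrier = carrier (quot_module A J), mult = mult (quot_module A J),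
     one = one (quot_module A J), zero = zero (quot_module A J), add = add (quot_module A J),
     smult = smult (quot_module A J), aug = (\<lambda>C. the_elem (aug A ` C))\<rparr>"

definition fin_gen_module ::
  "('k, 'm) ring_scheme \<Rightarrow> ('k, 'a, 'n) module_scheme \<Rightarrow> bool"
  where "fin_gen_module k M \<longleftrightarrow>
    (\<exists>S. finite S \<and> S \<subseteq> carrier M \<and>
      carrier M = {(\<Oplus>\<^bsub>M\<^esub>s\<in>S. c s \<odot>\<^bsub>M\<^esub> s) | c. c \<in> S \<rightarrow> carrier k})"

definition finite_type ::
  "('k, 'm) ring_scheme \<Rightarrow> ('k, 'a, 'n) aug_algebra_scheme \<Rightarrow> bool"
  where "finite_type k A \<longleftrightarrow>
    fin_gen_module k
      (quot_module (A\<lparr>carrier := aug_ideal k A\<rparr>) (ideal_power A (aug_ideal k A) 2))"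


section \<open>Completion\<close>

text \<open>An element of the inverse limit is a family of cosets \<open>x n \<in> A / I^n\<close>; the transition map
  \<open>A / I^(n+1) \<rightarrow> A / I^n\<close> sends a coset \<open>C\<close> to \<open>I^n + C\<close>. The augmentation is that of the component
  in \<open>A / I\<close>.\<close>

definition completion ::
  "('k, 'm) ring_scheme \<Rightarrow> ('k, 'a, 'n) aug_algebra_scheme \<Rightarrow> ('k, nat \<Rightarrow> 'a set) aug_algebra"
  where "completion k A =
    (let P = ideal_power A (aug_ideal k A); Q = (\<lambda>n. quot_module A (P n)) in
    \<lparr>carrier = {x. \<forall>n. x n \<in> carrier (Q n) \<and> P n <+>\<^bsub>A\<^esub> x (Suc n) = x n},
     mult = (\<lambda>x y n. x n \<otimes>\<^bsub>Q n\<^esub> y n),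
     one = (\<lambda>n. \<one>\<^bsub>Q n\<^esub>),
     zero = (\<lambda>n. \<zero>\<^bsub>Q n\<^esub>),
     add = (\<lambda>x y n. x n \<oplus>\<^bsub>Q n\<^esub> y n),
     smult = (\<lambda>c x n. c \<odot>\<^bsub>Q n\<^esub> x n),
     aug = (\<lambda>x. aug (quot_aug_algebra A (P 1)) (x 1))\<rparr>)"

definition completion_map ::
  "('k, 'm) ring_scheme \<Rightarrow> ('k, 'a, 'n) aug_algebra_scheme \<Rightarrow> 'a \<Rightarrow> nat \<Rightarrow> 'a set"
  where "completion_map k A a = (\<lambda>n. ideal_power A (aug_ideal k A) n +>\<^bsub>A\<^esub> a)"

definition complete_aug_algebra ::
  "('k, 'm) ring_scheme \<Rightarrow> ('k, 'a, 'n) aug_algebra_scheme \<Rightarrow> bool"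
  where "complete_aug_algebra k A \<longleftrightarrow> completion_map k A \<in> aug_iso k A (completion k A)"

definition closed_ideal ::
  "('k, 'm) ring_scheme \<Rightarrow> ('k, 'a, 'n) aug_algebra_scheme \<Rightarrow> 'a set \<Rightarrow> bool"
  where "closed_ideal k A J \<longleftrightarrow>
    ideal J A \<and> J = (\<Inter>n. J <+>\<^bsub>A\<^esub> ideal_power A (aug_ideal k A) n)"


section \<open>Non-commutative formal power series\<close>

text \<open>A series is its family of coefficients, indexed by the words in \<open>X\<close>.\<close>

definition nc_power_series ::
  "('k, 'm) ring_scheme \<Rightarrow> 'x set \<Rightarrow> ('k, 'x list \<Rightarrow> 'k) aug_algebra"
  where "nc_power_series k X =
    \<lparr>carrier = lists X \<rightarrow>\<^sub>E carrier k,
     mult = (\<lambda>f g. \<lambda>w\<in>lists X.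
       \<Oplus>\<^bsub>k\<^esub>i\<in>{..length w}. f (take i w) \<otimes>\<^bsub>k\<^esub> g (drop i w)),
     one = (\<lambda>w\<in>lists X. if w = [] then \<one>\<^bsub>k\<^esub> else \<zero>\<^bsub>k\<^esub>),
     zero = (\<lambda>w\<in>lists X. \<zero>\<^bsub>k\<^esub>),
     add = (\<lambda>f g. \<lambda>w\<in>lists X. f w \<oplus>\<^bsub>k\<^esub> g w),
     smult = (\<lambda>c f. \<lambda>w\<in>lists X. c \<otimes>\<^bsub>k\<^esub> f w),
     aug = (\<lambda>f. f [])\<rparr>"

end

theory Submission
  imports Defs
begin

text \<open>\<open>A\<close> is complete iff it is \<open>I\<close>-adically separated and Cauchy sequences with
  \<open>s (n + 1) - s n \<in> I^n\<close> converge. In the series algebra over a finite alphabet, the powers of the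
  augmentation ideal are the series whose coefficients vanish on short words, so Cauchy sequences
  converge there; convergence passes to every quotient, and the quotient by a closed ideal is
  separated.

  Conversely, let \<open>y\<close> be a finite family of elements of \<open>I\<close> that spans \<open>I / I^2\<close>. If \<open>A\<close> is complete,
  evaluation of series at \<open>y\<close> converges and is a homomorphism to \<open>A\<close>. Its kernel is closed since \<open>A\<close>
  is separated, and it is onto since every element of \<open>I^n\<close> agrees modulo \<open>I^(n+1)\<close> with the value
  of a series in the \<open>n\<close>-th power of the augmentation ideal, so that the corrections can be summed
  up. Both the associativity of the product of series and the multiplicativity of evaluation follow
  by induction from the rule \<open>(f g)_x = f g_x + g_1 f_x\<close>, where \<open>f_x\<close> has the coefficients
  \<open>f_x (w) = f (w x)\<close> and \<open>g_1\<close> is the constant coefficient of \<open>g\<close>.\<close>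

section \<open>Congruences and powers of ideals\<close>

text \<open>Powers of an ideal consist of finite sums of products, whereas
  \<open>vanishing_below n\<close> is a condition on single coefficients. Splitting a series by its
  last letter, f = sum of f_x x, reconciles the two, but only over a finite alphabet: over an
  infinite one the sum of all x^2 need not lie in I^2. The last letter is the one to split off
  because \<open>ideal_power\<close> appends its factors on the right, so that each letter accounts
  for one power of I.

  Truncating a series to words shorter than n gives a value in A, but this is not multiplicative: a
  product of two truncations contains words of length n and more. All laws are therefore proved as
  congruences modulo I^n, and separatedness turns them into equalities for the limit.

  Closedness is what makes the quotient separated: an element of every I(A)^n lifts to an f that
  lies in J + I^n for every n. The quotient P/J is always replaced by a surjection P -> A with
  kernel J, along which congruences are lifted and pushed forward.\<close>

no_notation Sum_Type.Plus (infixr \<open><+>\<close> 65)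

context ideal
begin

lemma diff_self: "a \<in> carrier R \<Longrightarrow> a \<ominus> a \<in> I"
  by (simp add: r_neg a_minus_def)

lemma diff_sym:
  assumes "a \<in> carrier R" "b \<in> carrier R" "a \<ominus> b \<in> I"
  shows "b \<ominus> a \<in> I"
proof -
  have "b \<ominus> a = \<ominus> (a \<ominus> b)" using assms by algebra
  with assms show ?thesis by simp
qed

lemma diff_trans:
  assumes "a \<in> carrier R" "b \<in> carrier R" "c \<in> carrier R" "a \<ominus> b \<in> I" "b \<ominus> c \<in> I"
  shows "a \<ominus> c \<in> I"
proof -
  have "a \<ominus> c = (a \<ominus> b) \<oplus> (b \<ominus> c)" using assms by algebra
  with assms show ?thesis by simp
qed

lemma diff_add:
  assumes "a \<in> carrier R" "b \<in> carrier R" "c \<in> carrier R" "d \<in> carrier R"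
    and "a \<ominus> b \<in> I" "c \<ominus> d \<in> I"
  shows "(a \<oplus> c) \<ominus> (b \<oplus> d) \<in> I"
proof -
  have "(a \<oplus> c) \<ominus> (b \<oplus> d) = (a \<ominus> b) \<oplus> (c \<ominus> d)" using assms by algebra
  with assms show ?thesis by simp
qed

lemma diff_mult:
  assumes "a \<in> carrier R" "b \<in> carrier R" "c \<in> carrier R" "d \<in> carrier R"
    and "a \<ominus> b \<in> I" "c \<ominus> d \<in> I"
  shows "(a \<otimes> c) \<ominus> (b \<otimes> d) \<in> I"
proof -
  have "(a \<otimes> c) \<ominus> (b \<otimes> d) = (a \<ominus> b) \<otimes> c \<oplus> b \<otimes> (c \<ominus> d)" using assms by algebra
  with assms show ?thesis by (simp add: I_l_closed I_r_closed)
qed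

lemma rcos_eq_iff_diff:
  assumes "a \<in> carrier R" "b \<in> carrier R"
  shows "I +> a = I +> b \<longleftrightarrow> a \<ominus> b \<in> I"
  using quotient_eq_iff_same_a_r_cos[OF is_ideal assms] by simp

lemma mem_rcos_iff_diff:
  assumes "a \<in> carrier R" "b \<in> carrier R"
  shows "b \<in> I +> a \<longleftrightarrow> b \<ominus> a \<in> I"
  using a_rcos_module_minus[OF ring_axioms assms] .

lemma finsum_in_ideal:
  assumes "f \<in> S \<rightarrow> I"
  shows "(\<Oplus>s\<in>S. f s) \<in> I"
  using assms
proof (induction S rule: infinite_finite_induct)
  case (insert s S)
  then have "f \<in> S \<rightarrow> carrier R" "f s \<in> carrier R"
    by (auto simp: Pi_iff intro: Icarr)
  with insert show ?case by (simp add: Pi_def)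
qed simp_all

lemma diff_finsum:
  assumes "finite S" "F \<in> S \<rightarrow> carrier R" "G \<in> S \<rightarrow> carrier R" "\<And>s. s \<in> S \<Longrightarrow> F s \<ominus> G s \<in> I"
  shows "(\<Oplus>s\<in>S. F s) \<ominus> (\<Oplus>s\<in>S. G s) \<in> I"
  using assms
proof (induction S rule: finite_induct)
  case empty
  then show ?case using diff_self[OF zero_closed] by simp
next
  case (insert s S)
  then have *: "F \<in> S \<rightarrow> carrier R" "F s \<in> carrier R" "G \<in> S \<rightarrow> carrier R" "G s \<in> carrier R"
    by auto
  with insert show ?case by (simp add: diff_add)
qed

end

text \<open>Computes the transition maps of the completion: adding \<open>J\<close> to a coset of a
  smaller ideal \<open>K\<close> keeps the representative, since \<open>J\<close> absorbs
  \<open>K\<close>.\<close>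

lemma (in ring) set_add_rcos_absorb:
  assumes "ideal J R" "ideal K R" "K \<subseteq> J" "a \<in> carrier R"
  shows "J <+> (K +> a) = J +> a"
proof -
  interpret J: ideal J R by fact
  interpret K: ideal K R by fact
  have "J <+> K = J"
  proof
    show "J <+> K \<subseteq> J" using assms(3) by (auto simp: set_add_def')
    show "J \<subseteq> J <+> K"
    proof
      fix j assume "j \<in> J"
      then have "j = j \<oplus> \<zero>" by simp
      with \<open>j \<in> J\<close> show "j \<in> J <+> K" unfolding set_add_def' using K.zero_closed by blast
    qed
  qed
  then show ?thesis
    using a_setmult_rcos_assoc[OF J.a_subset K.a_subset assms(4)] by simp
qed

section \<open>Powers of an ideal\<close>

context ring
begin

lemma diff_eq_zero_iff:
  assumes "a \<in> carrier R" "b \<in> carrier R"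
  shows "a \<ominus> b = \<zero> \<longleftrightarrow> a = b"
proof
  assume "a \<ominus> b = \<zero>"
  moreover have "a = (a \<ominus> b) \<oplus> b" using assms by algebra
  ultimately show "a = b" using assms by simp
qed (use assms in \<open>simp add: a_minus_def r_neg\<close>)

lemma ideal_power_ideal: "ideal I R \<Longrightarrow> ideal (ideal_power R I n) R"
  by (induction n) (simp_all add: oneideal ideal_prod_is_ideal)

lemma ideal_power_carrier: "ideal I R \<Longrightarrow> ideal_power R I n \<subseteq> carrier R"
  using ideal.Icarr[OF ideal_power_ideal] by auto

lemma ideal_power_1:
  assumes "ideal I R"
  shows "ideal_power R I (Suc 0) = I"
proof -
  interpret ideal I R by fact
  \<comment> \<open>The power with exponent 1 is the product of the whole ring with
    \<open>I\<close>; the unit exhibits each element of \<open>I\<close> as such a product.\<close>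
  have "I \<subseteq> carrier R \<cdot> I"
    using ideal_prod.prod[of \<one> "carrier R" _ I R] by (force simp: Icarr)
  then show ?thesis
    using ideal_prod_inter[OF oneideal assms] by auto
qed

lemma ideal_power_Suc_subset:
  "ideal I R \<Longrightarrow> ideal_power R I (Suc n) \<subseteq> ideal_power R I n"
  using ideal_prod_inter[OF ideal_power_ideal] by auto

text \<open>Powers grow by factors \<open>I\<close> on the right, so the induction runs over the
  exponent of the right factor: in x (i j) = (x i) j the product x i falls under the induction
  hypothesis.\<close>

lemma ideal_power_mult:
  assumes "ideal I R" "x \<in> ideal_power R I m" "y \<in> ideal_power R I n"
  shows "x \<otimes> y \<in> ideal_power R I (m + n)"
  using assms(3)
proof (induction n arbitrary: y)
  case 0
  interpret ideal "ideal_power R I m" R by (rule ideal_power_ideal[OF assms(1)])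
  from 0 assms show ?case by (simp add: I_r_closed)
next
  case (Suc n)
  note carr = ideal_power_carrier[OF assms(1)]
  have I: "I \<subseteq> carrier R" using ideal.Icarr[OF assms(1)] by auto
  from Suc.prems have "y \<in> ideal_power R I n \<cdot> I" by simp
  then show ?case
  proof induction
    case (prod i j)
    then have "x \<otimes> (i \<otimes> j) = (x \<otimes> i) \<otimes> j"
      using assms(2) carr I by (metis m_assoc subsetD)
    with ideal_prod.prod[OF Suc.IH[OF prod(1)] prod(2)] show ?case by simp
  next
    case (sum s t)
    then have "s \<in> carrier R" "t \<in> carrier R"
      using ideal_prod_in_carrier[OF ideal_power_ideal assms(1)] assms(1) by auto
    then have "x \<otimes> (s \<oplus> t) = x \<otimes> s \<oplus> x \<otimes> t"
      using assms(2) carr by (meson r_distr subsetD)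
    with sum.IH show ?case by (auto intro: ideal_prod.sum)
  qed
qed

end

section \<open>Powers of ideals under ring homomorphisms\<close>

context ring_hom_ring
begin

lemma hom_ideal_power_subset:
  assumes "ideal I R" "ideal J S" "h ` I \<subseteq> J"
  shows "h ` ideal_power R I n \<subseteq> ideal_power S J n"
proof (induction n)
  case (Suc n)
  note carr = R.ideal_power_carrier[OF assms(1), of n] ideal.Icarr[OF assms(1)]
  have "h x \<in> ideal_prod S (ideal_power S J n) J" if "x \<in> ideal_prod R (ideal_power R I n) I" for x
    using that
  proof induction
    case (prod i j)
    then have "h (i \<otimes>\<^bsub>R\<^esub> j) = h i \<otimes>\<^bsub>S\<^esub> h j" using carr by (auto simp: subset_iff)
    with prod Suc assms(3) show ?case by (auto intro!: ideal_prod.prod)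
  next
    case (sum s t)
    then have "s \<in> carrier R" "t \<in> carrier R"
      using R.ideal_prod_in_carrier[OF R.ideal_power_ideal assms(1)] assms(1) by auto
    with sum.IH show ?case by (auto intro: ideal_prod.sum)
  qed
  then show ?case by auto
qed auto

text \<open>Products lift factor by factor and sums term by term; exponent 0 needs \<open>h\<close>
  itself to be onto. This is what allows congruences modulo a power to be lifted along a quotient
  map.\<close>

lemma hom_ideal_power_image:
  assumes "ideal I R" "ideal J S" "h ` carrier R = carrier S" "h ` I = J"
  shows "h ` ideal_power R I n = ideal_power S J n"
proof (induction n)
  case (Suc n)
  note carr = R.ideal_power_carrier[OF assms(1), of n] ideal.Icarr[OF assms(1)]
  have "y \<in> h ` ideal_prod R (ideal_power R I n) I" if "y \<in> ideal_prod S (ideal_power S J n) J" for y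
    using that
  proof induction
    case (prod i j)
    then obtain u v where uv: "u \<in> ideal_power R I n" "i = h u" "v \<in> I" "j = h v"
      using Suc assms(4) by blast
    then have "i \<otimes>\<^bsub>S\<^esub> j = h (u \<otimes>\<^bsub>R\<^esub> v)" using carr by (auto simp: subset_iff)
    with uv show ?case by (auto intro!: ideal_prod.prod)
  next
    case (sum s t)
    then obtain u v where uv: "u \<in> ideal_prod R (ideal_power R I n) I" "s = h u"
      "v \<in> ideal_prod R (ideal_power R I n) I" "t = h v" by blast
    then have "u \<in> carrier R" "v \<in> carrier R"
      using R.ideal_prod_in_carrier[OF R.ideal_power_ideal assms(1)] assms(1) by auto
    with uv have "s \<oplus>\<^bsub>S\<^esub> t = h (u \<oplus>\<^bsub>R\<^esub> v)" by simp
    with uv show ?case by (auto intro!: ideal_prod.sum)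
  qed
  with hom_ideal_power_subset[OF assms(1,2), of "Suc n"] assms(4) show ?case by auto
qed (use assms in auto)

end

section \<open>Completeness as separatedness and convergence of Cauchy sequences\<close>

declare ideal_power.simps(2) [simp del]

lemma quot_simps:
  "carrier (quot_module M N) = a_rcosets\<^bsub>M\<^esub> N"
  "mult (quot_module M N) = rcoset_mult M N"
  "one (quot_module M N) = N +>\<^bsub>M\<^esub> \<one>\<^bsub>M\<^esub>"
  "zero (quot_module M N) = N"
  "add (quot_module M N) = set_add M"
  "smult (quot_module M N) = (\<lambda>c C. \<Union>x\<in>C. N +>\<^bsub>M\<^esub> (c \<odot>\<^bsub>M\<^esub> x))"
  "carrier (quot_aug_algebra A J) = a_rcosets\<^bsub>A\<^esub> J"
  "mult (quot_aug_algebra A J) = rcoset_mult A J"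
  "one (quot_aug_algebra A J) = J +>\<^bsub>A\<^esub> \<one>\<^bsub>A\<^esub>"
  "zero (quot_aug_algebra A J) = J"
  "add (quot_aug_algebra A J) = set_add A"
  "smult (quot_aug_algebra A J) = smult (quot_module A J)"
  "aug (quot_aug_algebra A J) = (\<lambda>C. the_elem (aug A ` C))"
  by (simp_all add: quot_module_def quot_aug_algebra_def FactRing_def)

context augmented_algebra
begin

sublocale aug_hom: ring_hom_ring A k "aug A"
  by unfold_locales (rule aug_ring_hom)

declare aug_hom.kernel_zero [simp del]  \<comment> \<open>loops together with the definition of \<^const>\<open>a_kernel\<close>\<close>

lemma aug_diff [simp]:
  "\<lbrakk>x \<in> carrier A; y \<in> carrier A\<rbrakk> \<Longrightarrow> aug A (x \<ominus>\<^bsub>A\<^esub> y) = aug A x \<ominus> aug A y"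
  by (simp add: a_minus_def)

lemma mem_aug_ideal: "x \<in> aug_ideal k A \<longleftrightarrow> x \<in> carrier A \<and> aug A x = \<zero>"
  by (auto simp: aug_ideal_def a_kernel_def')

lemma ideal_aug_ideal: "ideal (aug_ideal k A) A"
  unfolding aug_ideal_def by (rule aug_hom.kernel_is_ideal)

abbreviation aug_power :: "nat \<Rightarrow> 'a set"  (\<open>\<I>\<close>)
  where "\<I> n \<equiv> ideal_power A (aug_ideal k A) n"

lemma ideal_aug_power: "ideal (\<I> n) A"
  by (rule A.ideal_power_ideal[OF ideal_aug_ideal])

lemma aug_power_1: "\<I> (Suc 0) = aug_ideal k A"
  by (rule A.ideal_power_1[OF ideal_aug_ideal])

text \<open>Scalars act as multiplication by elements of \<open>A\<close>; hence every ring ideal is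
  a submodule, and the quotients inherit the action of \<open>k\<close>.\<close>

lemma smult_mult_one:
  assumes "c \<in> carrier k" "x \<in> carrier A"
  shows "c \<odot>\<^bsub>A\<^esub> x = (c \<odot>\<^bsub>A\<^esub> \<one>\<^bsub>A\<^esub>) \<otimes>\<^bsub>A\<^esub> x"
  using assms by (simp add: smult_mult_left)

lemma ideal_smult_closed:
  assumes "ideal J A" "c \<in> carrier k" "x \<in> J"
  shows "c \<odot>\<^bsub>A\<^esub> x \<in> J"
proof -
  interpret J: ideal J A by fact
  show ?thesis using assms by (subst smult_mult_one) (auto intro: J.I_l_closed)
qed

lemma smult_r_diff:
  assumes "c \<in> carrier k" "x \<in> carrier A" "y \<in> carrier A"
  shows "c \<odot>\<^bsub>A\<^esub> (x \<ominus>\<^bsub>A\<^esub> y) = c \<odot>\<^bsub>A\<^esub> x \<ominus>\<^bsub>A\<^esub> c \<odot>\<^bsub>A\<^esub> y"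
  using assms by (simp add: a_minus_def smult_r_distr smult_r_minus)

text \<open>The action on cosets is a union over all members of the coset; it is well defined
  because all members yield the same coset.\<close>

lemma smult_rcos:
  assumes "ideal J A" "c \<in> carrier k" "x \<in> carrier A"
  shows "c \<odot>\<^bsub>quot_module A J\<^esub> (J +>\<^bsub>A\<^esub> x) = J +>\<^bsub>A\<^esub> (c \<odot>\<^bsub>A\<^esub> x)"
proof -
  interpret J: ideal J A by fact
  have "J +>\<^bsub>A\<^esub> (c \<odot>\<^bsub>A\<^esub> y) = J +>\<^bsub>A\<^esub> (c \<odot>\<^bsub>A\<^esub> x)" if "y \<in> J +>\<^bsub>A\<^esub> x" for y
  proof -
    have y: "y \<in> carrier A" using J.a_elemrcos_carrier[OF assms(3) that] .
    with that assms have "y \<ominus>\<^bsub>A\<^esub> x \<in> J" by (simp add: J.mem_rcos_iff_diff)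
    with assms y have "c \<odot>\<^bsub>A\<^esub> y \<ominus>\<^bsub>A\<^esub> c \<odot>\<^bsub>A\<^esub> x \<in> J"
      by (metis ideal_smult_closed smult_r_diff)
    with assms y show ?thesis by (simp add: J.rcos_eq_iff_diff)
  qed
  moreover have "x \<in> J +>\<^bsub>A\<^esub> x" using assms by (simp add: J.a_rcos_self)
  ultimately have "(\<Union>y\<in>J +>\<^bsub>A\<^esub> x. J +>\<^bsub>A\<^esub> (c \<odot>\<^bsub>A\<^esub> y)) = J +>\<^bsub>A\<^esub> (c \<odot>\<^bsub>A\<^esub> x)" by blast
  then show ?thesis by (simp only: quot_simps)
qed

text \<open>\<open>the_elem\<close> is meaningful because two members of a coset differ by an
  element of \<open>J\<close>, on which the augmentation vanishes.\<close>

lemma aug_rcos: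
  assumes "ideal J A" "J \<subseteq> aug_ideal k A" "x \<in> carrier A"
  shows "aug (quot_aug_algebra A J) (J +>\<^bsub>A\<^esub> x) = aug A x"
proof -
  interpret J: ideal J A by fact
  have "aug A y = aug A x" if "y \<in> J +>\<^bsub>A\<^esub> x" for y
  proof -
    have y: "y \<in> carrier A" using J.a_elemrcos_carrier[OF assms(3) that] .
    with that assms have "y \<ominus>\<^bsub>A\<^esub> x \<in> aug_ideal k A" by (auto simp: J.mem_rcos_iff_diff)
    then have "aug A y \<ominus> aug A x = \<zero>"
      using y assms by (simp add: mem_aug_ideal)
    with y assms show ?thesis using R.diff_eq_zero_iff by simp
  qed
  moreover have "x \<in> J +>\<^bsub>A\<^esub> x" using assms by (simp add: J.a_rcos_self)
  ultimately have "aug A ` (J +>\<^bsub>A\<^esub> x) = {aug A x}" by blast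
  then show ?thesis by (simp add: quot_simps)
qed

lemma rcosets_eq_image: "a_rcosets\<^bsub>A\<^esub> J = (\<lambda>x. J +>\<^bsub>A\<^esub> x) ` carrier A"
  by (auto simp: A_RCOSETS_def')

lemma completion_simps:
  "carrier (completion k A) =
    {x. \<forall>n. x n \<in> a_rcosets\<^bsub>A\<^esub> (\<I> n) \<and> \<I> n <+>\<^bsub>A\<^esub> x (Suc n) = x n}"
  "mult (completion k A) = (\<lambda>x y n. rcoset_mult A (\<I> n) (x n) (y n))"
  "one (completion k A) = (\<lambda>n. \<I> n +>\<^bsub>A\<^esub> \<one>\<^bsub>A\<^esub>)"
  "add (completion k A) = (\<lambda>x y n. x n <+>\<^bsub>A\<^esub> y n)"
  "smult (completion k A) = (\<lambda>c x n. c \<odot>\<^bsub>quot_module A (\<I> n)\<^esub> x n)"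
  "aug (completion k A) = (\<lambda>x. aug (quot_aug_algebra A (aug_ideal k A)) (x (Suc 0)))"
  using aug_power_1 by (simp_all add: completion_def Let_def quot_simps)

text \<open>Choosing representatives turns a compatible family of cosets into a sequence:
  compatibility at stage \<open>n\<close> is exactly the congruence of \<open>s (Suc n)\<close> and
  \<open>s n\<close> modulo \<open>I^n\<close>.\<close>

lemma mem_carrier_completion_iff:
  "x \<in> carrier (completion k A) \<longleftrightarrow>
    (\<exists>s. (\<forall>n. s n \<in> carrier A \<and> s (Suc n) \<ominus>\<^bsub>A\<^esub> s n \<in> \<I> n \<and> x n = \<I> n +>\<^bsub>A\<^esub> s n))"
  (is "_ \<longleftrightarrow> ?R")
proof -
  have transition: "\<I> n <+>\<^bsub>A\<^esub> (\<I> (Suc n) +>\<^bsub>A\<^esub> b) = \<I> n +>\<^bsub>A\<^esub> a \<longleftrightarrow> b \<ominus>\<^bsub>A\<^esub> a \<in> \<I> n"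
    if "a \<in> carrier A" "b \<in> carrier A" for a b n
  proof -
    interpret J: ideal "\<I> n" A by (rule ideal_aug_power)
    show ?thesis
      using A.set_add_rcos_absorb[OF ideal_aug_power ideal_aug_power _ that(2)]
        A.ideal_power_Suc_subset[OF ideal_aug_ideal] that J.rcos_eq_iff_diff J.diff_sym by auto
  qed
  show ?thesis
  proof
    assume x: "x \<in> carrier (completion k A)"
    then have "\<forall>n. \<exists>a. a \<in> carrier A \<and> x n = \<I> n +>\<^bsub>A\<^esub> a"
      by (simp add: completion_simps rcosets_eq_image) blast
    then obtain s where s: "\<And>n. s n \<in> carrier A" "\<And>n. x n = \<I> n +>\<^bsub>A\<^esub> s n" by metis
    moreover have "s (Suc n) \<ominus>\<^bsub>A\<^esub> s n \<in> \<I> n" for n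
    proof -
      from x have "\<I> n <+>\<^bsub>A\<^esub> x (Suc n) = x n" by (simp add: completion_simps)
      with s transition show ?thesis by metis
    qed
    ultimately show ?R by blast
  next
    assume ?R
    then obtain s where s: "\<And>n. s n \<in> carrier A" "\<And>n. x n = \<I> n +>\<^bsub>A\<^esub> s n"
      "\<And>n. s (Suc n) \<ominus>\<^bsub>A\<^esub> s n \<in> \<I> n" by blast
    then have "\<I> n <+>\<^bsub>A\<^esub> x (Suc n) = x n" for n using transition by metis
    with s show "x \<in> carrier (completion k A)" by (simp add: completion_simps rcosets_eq_image)
  qed
qed

lemma completion_map_aug_hom: "completion_map k A \<in> aug_hom k A (completion k A)"
proof -
  have "completion_map k A a \<in> carrier (completion k A)" if "a \<in> carrier A" for a
    unfolding mem_carrier_completion_iff completion_map_def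
    by (rule exI[of _ "\<lambda>_. a"])
      (use that in \<open>simp add: ideal.diff_self[OF ideal_aug_power]\<close>)
  moreover have "completion_map k A (a \<otimes>\<^bsub>A\<^esub> b)
      = completion_map k A a \<otimes>\<^bsub>completion k A\<^esub> completion_map k A b"
    "completion_map k A (a \<oplus>\<^bsub>A\<^esub> b)
      = completion_map k A a \<oplus>\<^bsub>completion k A\<^esub> completion_map k A b"
    if "a \<in> carrier A" "b \<in> carrier A" for a b
    using that ideal.rcoset_mult_add[OF ideal_aug_power] ideal.a_rcos_sum[OF ideal_aug_power]
    by (simp_all add: completion_map_def completion_simps)
  moreover have "completion_map k A \<one>\<^bsub>A\<^esub> = \<one>\<^bsub>completion k A\<^esub>"
    by (simp add: completion_map_def completion_simps)
  ultimately have "completion_map k A \<in> ring_hom A (completion k A)"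
    by (intro ring_hom_memI)
  moreover have "completion_map k A (c \<odot>\<^bsub>A\<^esub> a) = c \<odot>\<^bsub>completion k A\<^esub> completion_map k A a"
    if "c \<in> carrier k" "a \<in> carrier A" for c a
    using smult_rcos[OF ideal_aug_power that]
    by (simp add: completion_map_def completion_simps)
  moreover have "aug (completion k A) (completion_map k A a) = aug A a" if "a \<in> carrier A" for a
    using aug_rcos[OF ideal_aug_ideal _ that]
    by (simp add: completion_map_def completion_simps aug_power_1)
  ultimately show ?thesis by (simp add: aug_hom_def)
qed

definition adic_separated :: bool
  where "adic_separated \<longleftrightarrow> (\<forall>a\<in>carrier A. (\<forall>n. a \<in> \<I> n) \<longrightarrow> a = \<zero>\<^bsub>A\<^esub>)"

text \<open>The rate of convergence is tied to the index, as for representatives of an element of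
  the inverse limit; the limit then has the same class as \<open>s n\<close> at every stage
  \<open>n\<close>.\<close>

definition adic_cauchy_complete :: bool
  where "adic_cauchy_complete \<longleftrightarrow>
    (\<forall>s. (\<forall>n. s n \<in> carrier A \<and> s (Suc n) \<ominus>\<^bsub>A\<^esub> s n \<in> \<I> n) \<longrightarrow>
      (\<exists>a\<in>carrier A. \<forall>n. a \<ominus>\<^bsub>A\<^esub> s n \<in> \<I> n))"

lemma adic_separatedD:
  assumes "adic_separated" "a \<in> carrier A" "b \<in> carrier A" "\<And>n. a \<ominus>\<^bsub>A\<^esub> b \<in> \<I> n"
  shows "a = b"
proof -
  have "a \<ominus>\<^bsub>A\<^esub> b = \<zero>\<^bsub>A\<^esub>"
    using assms unfolding adic_separated_def by auto
  then show ?thesis using assms A.diff_eq_zero_iff by simp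
qed

lemma adic_cauchy_completeE:
  assumes "adic_cauchy_complete" "\<And>n. s n \<in> carrier A" "\<And>n. s (Suc n) \<ominus>\<^bsub>A\<^esub> s n \<in> \<I> n"
  obtains a where "a \<in> carrier A" "\<And>n. a \<ominus>\<^bsub>A\<^esub> s n \<in> \<I> n"
  using assms unfolding adic_cauchy_complete_def by metis

lemma complete_iff:
  "complete_aug_algebra k A \<longleftrightarrow> adic_separated \<and> adic_cauchy_complete"
proof -
  \<comment> \<open>One criterion serves both halves: applied to constant sequences it characterizes
    injectivity, applied to Cauchy sequences surjectivity.\<close>
  have eq: "completion_map k A a = (\<lambda>n. \<I> n +>\<^bsub>A\<^esub> s n) \<longleftrightarrow> (\<forall>n. a \<ominus>\<^bsub>A\<^esub> s n \<in> \<I> n)"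
    if "a \<in> carrier A" "\<And>n. s n \<in> carrier A" for a s
    using that by (simp add: completion_map_def fun_eq_iff ideal.rcos_eq_iff_diff[OF ideal_aug_power])
  have "inj_on (completion_map k A) (carrier A) \<longleftrightarrow> adic_separated"
  proof
    assume inj: "inj_on (completion_map k A) (carrier A)"
    show adic_separated
      unfolding adic_separated_def
    proof (intro ballI impI)
      fix a assume a: "a \<in> carrier A" "\<forall>n. a \<in> \<I> n"
      then have "completion_map k A a = completion_map k A \<zero>\<^bsub>A\<^esub>"
        using eq[of a "\<lambda>_. \<zero>\<^bsub>A\<^esub>"] by (simp add: completion_map_def a_minus_def)
      with inj a show "a = \<zero>\<^bsub>A\<^esub>" by (simp add: inj_on_eq_iff)
    qed
  next
    assume sep: adic_separated
    show "inj_on (completion_map k A) (carrier A)"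
    proof (rule inj_onI)
      fix a b assume ab: "a \<in> carrier A" "b \<in> carrier A" "completion_map k A a = completion_map k A b"
      then have "\<forall>n. a \<ominus>\<^bsub>A\<^esub> b \<in> \<I> n"
        using eq[of a "\<lambda>_. b"] by (simp add: completion_map_def)
      with sep ab show "a = b" by (auto intro: adic_separatedD)
    qed
  qed
  moreover have "completion_map k A ` carrier A = carrier (completion k A) \<longleftrightarrow> adic_cauchy_complete"
  proof
    assume surj: "completion_map k A ` carrier A = carrier (completion k A)"
    show adic_cauchy_complete
      unfolding adic_cauchy_complete_def
    proof (intro allI impI)
      fix s assume s: "\<forall>n. s n \<in> carrier A \<and> s (Suc n) \<ominus>\<^bsub>A\<^esub> s n \<in> \<I> n"
      then have "(\<lambda>n. \<I> n +>\<^bsub>A\<^esub> s n) \<in> carrier (completion k A)"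
        unfolding mem_carrier_completion_iff by auto
      then have "(\<lambda>n. \<I> n +>\<^bsub>A\<^esub> s n) \<in> completion_map k A ` carrier A" by (simp only: surj)
      then obtain a where a: "(\<lambda>n. \<I> n +>\<^bsub>A\<^esub> s n) = completion_map k A a" "a \<in> carrier A"
        by (rule imageE)
      then have "\<forall>n. a \<ominus>\<^bsub>A\<^esub> s n \<in> \<I> n" using eq[of a s] s by simp
      with a show "\<exists>a\<in>carrier A. \<forall>n. a \<ominus>\<^bsub>A\<^esub> s n \<in> \<I> n" by blast
    qed
  next
    assume complete: adic_cauchy_complete
    show "completion_map k A ` carrier A = carrier (completion k A)"
    proof
      show "completion_map k A ` carrier A \<subseteq> carrier (completion k A)"
        using completion_map_aug_hom by (auto simp: aug_hom_def ring_hom_def)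
      show "carrier (completion k A) \<subseteq> completion_map k A ` carrier A"
      proof
        fix x assume "x \<in> carrier (completion k A)"
        then obtain s where s: "\<And>n. s n \<in> carrier A" "\<And>n. s (Suc n) \<ominus>\<^bsub>A\<^esub> s n \<in> \<I> n"
          "\<And>n. x n = \<I> n +>\<^bsub>A\<^esub> s n"
          unfolding mem_carrier_completion_iff by blast
        obtain a where "a \<in> carrier A" "\<And>n. a \<ominus>\<^bsub>A\<^esub> s n \<in> \<I> n"
          using adic_cauchy_completeE[OF complete s(1,2)] by blast
        then have "completion_map k A a = (\<lambda>n. \<I> n +>\<^bsub>A\<^esub> s n)"
          using eq s(1) by blast
        also have "\<dots> = x" by (rule ext) (simp add: s(3))
        finally have "completion_map k A a = x" .
        with \<open>a \<in> carrier A\<close> show "x \<in> completion_map k A ` carrier A" by blast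
      qed
    qed
  qed
  ultimately show ?thesis
    using completion_map_aug_hom by (auto simp: complete_aug_algebra_def aug_iso_def bij_betw_def)
qed

end

section \<open>Homomorphisms and quotients of augmented algebras\<close>

locale aug_algebra_hom = P: augmented_algebra k P + A: augmented_algebra k A
  for k :: "('k, 'm) ring_scheme" and P :: "('k, 'p, 'n) aug_algebra_scheme"
    and A :: "('k, 'a, 'l) aug_algebra_scheme" +
  fixes \<phi> :: "'p \<Rightarrow> 'a"
  assumes aug_hom: "\<phi> \<in> aug_hom k P A"
begin

sublocale hom: ring_hom_ring P A \<phi>
  using aug_hom by unfold_locales (simp add: aug_hom_def)

declare hom.kernel_zero [simp del]

lemma hom_smult:
  "\<lbrakk>c \<in> carrier k; x \<in> carrier P\<rbrakk> \<Longrightarrow> \<phi> (c \<odot>\<^bsub>P\<^esub> x) = c \<odot>\<^bsub>A\<^esub> \<phi> x"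
  using aug_hom by (simp add: aug_hom_def)

lemma aug_hom_apply: "x \<in> carrier P \<Longrightarrow> aug A (\<phi> x) = aug P x"
  using aug_hom by (simp add: aug_hom_def)

lemma hom_diff: "\<lbrakk>x \<in> carrier P; y \<in> carrier P\<rbrakk> \<Longrightarrow> \<phi> (x \<ominus>\<^bsub>P\<^esub> y) = \<phi> x \<ominus>\<^bsub>A\<^esub> \<phi> y"
  by (simp add: a_minus_def)

lemma mem_kernel: "f \<in> a_kernel P A \<phi> \<longleftrightarrow> f \<in> carrier P \<and> \<phi> f = \<zero>\<^bsub>A\<^esub>"
  by (auto simp: a_kernel_def')

lemma hom_eq_iff:
  "\<lbrakk>x \<in> carrier P; y \<in> carrier P\<rbrakk> \<Longrightarrow> \<phi> x = \<phi> y \<longleftrightarrow> x \<ominus>\<^bsub>P\<^esub> y \<in> a_kernel P A \<phi>"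
  by (simp add: mem_kernel hom_diff A.A.diff_eq_zero_iff)

lemma hom_aug_ideal: "x \<in> aug_ideal k P \<Longrightarrow> \<phi> x \<in> aug_ideal k A"
  by (simp add: P.mem_aug_ideal A.mem_aug_ideal aug_hom_apply)

lemma hom_aug_power: "x \<in> P.aug_power n \<Longrightarrow> \<phi> x \<in> A.aug_power n"
  using hom.hom_ideal_power_subset[OF P.ideal_aug_ideal A.ideal_aug_ideal image_subsetI]
  by (blast intro: hom_aug_ideal)

text \<open>Since \<phi> preserves augmentations, any preimage of an element of I(A) already lies in
  I(P); hence I(P) maps onto I(A), and powers map onto powers.\<close>

lemma hom_aug_power_surj:
  assumes "\<phi> ` carrier P = carrier A"
  shows "\<phi> ` P.aug_power n = A.aug_power n"
proof (rule hom.hom_ideal_power_image[OF P.ideal_aug_ideal A.ideal_aug_ideal assms])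
  show "\<phi> ` aug_ideal k P = aug_ideal k A"
  proof
    show "\<phi> ` aug_ideal k P \<subseteq> aug_ideal k A" by (rule image_subsetI) (rule hom_aug_ideal)
    show "aug_ideal k A \<subseteq> \<phi> ` aug_ideal k P"
    proof
      fix a assume a: "a \<in> aug_ideal k A"
      then have "a \<in> \<phi> ` carrier P" using assms by (simp add: A.mem_aug_ideal)
      then obtain f where f: "a = \<phi> f" "f \<in> carrier P" by (rule imageE)
      with a have "f \<in> aug_ideal k P" by (simp add: P.mem_aug_ideal A.mem_aug_ideal aug_hom_apply)
      with f show "a \<in> \<phi> ` aug_ideal k P" by blast
    qed
  qed
qed

lemma kernel_subset_aug_ideal: "a_kernel P A \<phi> \<subseteq> aug_ideal k P"
proof
  fix f assume "f \<in> a_kernel P A \<phi>"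
  then have f: "f \<in> carrier P" "\<phi> f = \<zero>\<^bsub>A\<^esub>" by (simp_all add: mem_kernel)
  from aug_hom_apply[OF f(1)] f show "f \<in> aug_ideal k P" by (simp add: P.mem_aug_ideal)
qed

text \<open>Elements of the kernel plus \<open>I^n\<close> have their image in I(A)^n; if this holds
  for all \<open>n\<close>, the image is zero by separatedness.\<close>

lemma closed_kernel:
  assumes "A.adic_separated"
  shows "closed_ideal k P (a_kernel P A \<phi>)"
proof -
  let ?J = "a_kernel P A \<phi>"
  have sub: "?J \<subseteq> ?J <+>\<^bsub>P\<^esub> P.aug_power n" for n
  proof
    fix f assume f: "f \<in> ?J"
    then have "f = f \<oplus>\<^bsub>P\<^esub> \<zero>\<^bsub>P\<^esub>" by (simp add: mem_kernel)
    moreover have "\<zero>\<^bsub>P\<^esub> \<in> P.aug_power n"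
      using additive_subgroup.zero_closed[OF ideal.axioms(1)[OF P.ideal_aug_power]] .
    ultimately show "f \<in> ?J <+>\<^bsub>P\<^esub> P.aug_power n" using f unfolding set_add_def' by blast
  qed
  have mem: "f \<in> ?J" if f: "\<And>n. f \<in> ?J <+>\<^bsub>P\<^esub> P.aug_power n" for f
  proof -
    have *: "f \<in> carrier P \<and> \<phi> f \<in> A.aug_power n" for n
    proof -
      from f[of n] obtain j p where jp: "j \<in> ?J" "p \<in> P.aug_power n" "f = j \<oplus>\<^bsub>P\<^esub> p"
        unfolding set_add_def' by blast
      then have p: "p \<in> carrier P" using ideal.Icarr[OF P.ideal_aug_power] by blast
      with jp have "\<phi> f = \<phi> p" by (simp add: mem_kernel)
      with jp p hom_aug_power show ?thesis by (simp add: mem_kernel)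
    qed
    with assms show ?thesis by (auto simp: mem_kernel A.adic_separated_def)
  qed
  have "?J = (\<Inter>n. ?J <+>\<^bsub>P\<^esub> P.aug_power n)"
  proof
    show "?J \<subseteq> (\<Inter>n. ?J <+>\<^bsub>P\<^esub> P.aug_power n)" by (rule INT_greatest) (rule sub)
    show "(\<Inter>n. ?J <+>\<^bsub>P\<^esub> P.aug_power n) \<subseteq> ?J"
      by (rule subsetI, rule mem) (drule INT_D, rule UNIV_I, assumption)
  qed
  then show ?thesis
    unfolding closed_ideal_def by (intro conjI hom.kernel_is_ideal)
qed

text \<open>An \<open>a\<close> in all powers has, besides one fixed preimage \<open>f\<close>, a
  preimage in each power of I(P). The two differ by an element of the kernel, so \<open>f\<close>
  lies in the closure of the kernel.\<close>

lemma adic_separated_of_closed_kernel: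
  assumes surj: "\<phi> ` carrier P = carrier A" and closed: "closed_ideal k P (a_kernel P A \<phi>)"
  shows "A.adic_separated"
  unfolding A.adic_separated_def
proof (intro ballI impI)
  let ?J = "a_kernel P A \<phi>"
  fix a assume a: "a \<in> carrier A" "\<forall>n. a \<in> A.aug_power n"
  then obtain f where f: "f \<in> carrier P" "a = \<phi> f" using surj by blast
  have "f \<in> ?J <+>\<^bsub>P\<^esub> P.aug_power n" for n
  proof -
    from a hom_aug_power_surj[OF surj] obtain p where p: "p \<in> P.aug_power n" "a = \<phi> p" by blast
    then have "p \<in> carrier P" using ideal.Icarr[OF P.ideal_aug_power] by blast
    then have "f = (f \<ominus>\<^bsub>P\<^esub> p) \<oplus>\<^bsub>P\<^esub> p" using f by algebra
    moreover have "f \<ominus>\<^bsub>P\<^esub> p \<in> ?J" using hom_eq_iff f p \<open>p \<in> carrier P\<close> by blast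
    ultimately show ?thesis using p unfolding set_add_def' by blast
  qed
  then have "f \<in> (\<Inter>n. ?J <+>\<^bsub>P\<^esub> P.aug_power n)" by (rule INT_I)
  also have "\<dots> = ?J" using closed by (simp only: closed_ideal_def)
  finally have "f \<in> ?J" .
  with f show "a = \<zero>\<^bsub>A\<^esub>" by (simp add: mem_kernel)
qed

lemma adic_cauchy_complete_of_surj:
  assumes surj: "\<phi> ` carrier P = carrier A" and "P.adic_cauchy_complete"
  shows "A.adic_cauchy_complete"
  unfolding A.adic_cauchy_complete_def
proof (intro allI impI)
  fix s assume s: "\<forall>n. s n \<in> carrier A \<and> s (Suc n) \<ominus>\<^bsub>A\<^esub> s n \<in> A.aug_power n"
  \<comment> \<open>Preimages are chosen one after the other: the difference of consecutive terms
    lifts to I(P)^n, so the lifted sequence is again Cauchy, which arbitrary preimages would not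
    ensure.\<close>
  have "\<exists>F. \<forall>n. (F n \<in> carrier P \<and> \<phi> (F n) = s n) \<and> F (Suc n) \<ominus>\<^bsub>P\<^esub> F n \<in> P.aug_power n"
  proof (rule dependent_nat_choice)
    show "\<exists>f. f \<in> carrier P \<and> \<phi> f = s 0" using s surj by (metis imageE)
    fix f n assume f: "f \<in> carrier P \<and> \<phi> f = s n"
    from s hom_aug_power_surj[OF surj] obtain p
      where p: "p \<in> P.aug_power n" "s (Suc n) \<ominus>\<^bsub>A\<^esub> s n = \<phi> p" by blast
    then have pc: "p \<in> carrier P" using ideal.Icarr[OF P.ideal_aug_power] by blast
    have "(f \<oplus>\<^bsub>P\<^esub> p) \<ominus>\<^bsub>P\<^esub> f = p" using f pc by algebra
    moreover have "s n \<oplus>\<^bsub>A\<^esub> (s (Suc n) \<ominus>\<^bsub>A\<^esub> s n) = s (Suc n)" using s by algebra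
    ultimately show "\<exists>g. (g \<in> carrier P \<and> \<phi> g = s (Suc n)) \<and> g \<ominus>\<^bsub>P\<^esub> f \<in> P.aug_power n"
      using f p pc by (intro exI[of _ "f \<oplus>\<^bsub>P\<^esub> p"]) simp
  qed
  then obtain F where F: "\<And>n. F n \<in> carrier P" "\<And>n. \<phi> (F n) = s n"
    "\<And>n. F (Suc n) \<ominus>\<^bsub>P\<^esub> F n \<in> P.aug_power n" by blast
  obtain f where f: "f \<in> carrier P" "\<And>n. f \<ominus>\<^bsub>P\<^esub> F n \<in> P.aug_power n"
    using P.adic_cauchy_completeE[OF assms(2) F(1,3)] by blast
  have "\<phi> f \<ominus>\<^bsub>A\<^esub> s n \<in> A.aug_power n" for n
    using hom_aug_power[OF f(2)[of n]] f F by (simp add: hom_diff)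
  with f show "\<exists>a\<in>carrier A. \<forall>n. a \<ominus>\<^bsub>A\<^esub> s n \<in> A.aug_power n"
    by (intro bexI[of _ "\<phi> f"]) auto
qed

lemma aug_isomorphic_quot_kernel:
  assumes surj: "\<phi> ` carrier P = carrier A"
  shows "aug_isomorphic k A (quot_aug_algebra P (a_kernel P A \<phi>))"
proof -
  let ?J = "a_kernel P A \<phi>"
  \<comment> \<open>The fibre over \<open>a\<close> is itself a coset of the kernel, so the map from
    \<open>A\<close> to the quotient is obtained without choosing preimages.\<close>
  define h where "h a = {f \<in> carrier P. \<phi> f = a}" for a
  interpret J: ideal ?J P by (rule hom.kernel_is_ideal)
  have h: "h (\<phi> f) = ?J +>\<^bsub>P\<^esub> f" if "f \<in> carrier P" for f
  proof (rule Set.set_eqI)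
    fix g
    show "g \<in> h (\<phi> f) \<longleftrightarrow> g \<in> ?J +>\<^bsub>P\<^esub> f"
    proof (cases "g \<in> carrier P")
      case True
      with that show ?thesis by (simp add: h_def J.mem_rcos_iff_diff hom_eq_iff)
    next
      case False
      with J.a_elemrcos_carrier[OF that] show ?thesis unfolding h_def by blast
    qed
  qed
  have lift: "\<exists>f\<in>carrier P. a = \<phi> f" if "a \<in> carrier A" for a using that surj by blast
  have "h \<in> ring_hom A (quot_aug_algebra P ?J)"
  proof (rule ring_hom_memI)
    fix a b assume "a \<in> carrier A" "b \<in> carrier A"
    from lift[OF this(1)] lift[OF this(2)]
    obtain f g where fg: "f \<in> carrier P" "g \<in> carrier P" "a = \<phi> f" "b = \<phi> g" by blast
    then show "h a \<in> carrier (quot_aug_algebra P ?J)"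
      by (simp add: h quot_simps P.rcosets_eq_image)
    have "h (\<phi> (f \<otimes>\<^bsub>P\<^esub> g)) = h (\<phi> f) \<otimes>\<^bsub>quot_aug_algebra P ?J\<^esub> h (\<phi> g)"
      using fg by (simp add: h quot_simps J.rcoset_mult_add del: hom.hom_mult)
    then show "h (a \<otimes>\<^bsub>A\<^esub> b) = h a \<otimes>\<^bsub>quot_aug_algebra P ?J\<^esub> h b" using fg by simp
    have "h (\<phi> (f \<oplus>\<^bsub>P\<^esub> g)) = h (\<phi> f) \<oplus>\<^bsub>quot_aug_algebra P ?J\<^esub> h (\<phi> g)"
      using fg by (simp add: h quot_simps J.a_rcos_sum del: hom.hom_add)
    then show "h (a \<oplus>\<^bsub>A\<^esub> b) = h a \<oplus>\<^bsub>quot_aug_algebra P ?J\<^esub> h b" using fg by simp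
  next
    show "h \<one>\<^bsub>A\<^esub> = \<one>\<^bsub>quot_aug_algebra P ?J\<^esub>"
      using h[of "\<one>\<^bsub>P\<^esub>"] by (simp add: quot_simps)
  qed
  moreover have "h (c \<odot>\<^bsub>A\<^esub> a) = c \<odot>\<^bsub>quot_aug_algebra P ?J\<^esub> h a"
    if c: "c \<in> carrier k" and a: "a \<in> carrier A" for c a
  proof -
    from lift[OF a] obtain f where f: "f \<in> carrier P" "a = \<phi> f" by blast
    with c have "h (\<phi> (c \<odot>\<^bsub>P\<^esub> f)) = c \<odot>\<^bsub>quot_aug_algebra P ?J\<^esub> h (\<phi> f)"
      using P.smult_rcos[OF J.is_ideal c] by (simp add: h quot_simps(12))
    with f c show ?thesis by (simp add: hom_smult)
  qed
  moreover have "aug (quot_aug_algebra P ?J) (h a) = aug A a" if "a \<in> carrier A" for a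
  proof -
    from lift[OF that] obtain f where f: "f \<in> carrier P" "a = \<phi> f" by blast
    then show ?thesis
      using P.aug_rcos[OF J.is_ideal kernel_subset_aug_ideal] by (simp add: h aug_hom_apply)
  qed
  moreover have "bij_betw h (carrier A) (carrier (quot_aug_algebra P ?J))"
    unfolding bij_betw_def
  proof
    show "inj_on h (carrier A)"
    proof (rule inj_onI)
      fix a b assume "a \<in> carrier A" "b \<in> carrier A" "h a = h b"
      with lift[of a] show "a = b" unfolding h_def by blast
    qed
    show "h ` carrier A = carrier (quot_aug_algebra P ?J)"
      unfolding surj[symmetric] by (simp add: image_image h quot_simps P.rcosets_eq_image)
  qed
  ultimately have "h \<in> aug_iso k A (quot_aug_algebra P ?J)"
    by (simp add: aug_iso_def aug_hom_def)
  then show ?thesis unfolding aug_isomorphic_def by blast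
qed

end

text \<open>The projection followed by the inverse isomorphism trades an isomorphism with the
  quotient for a surjection with kernel \<open>J\<close>, to which the transfer results for
  homomorphisms apply.\<close>

lemma aug_isomorphic_quotE:
  assumes A: "augmented_algebra k A" and P: "augmented_algebra k P"
    and J: "ideal J P" "J \<subseteq> aug_ideal k P"
    and iso: "aug_isomorphic k A (quot_aug_algebra P J)"
  obtains \<phi> where "aug_algebra_hom k P A \<phi>" "\<phi> ` carrier P = carrier A" "a_kernel P A \<phi> = J"
proof -
  interpret A: augmented_algebra k A by fact
  interpret P: augmented_algebra k P by fact
  interpret J: ideal J P by fact
  let ?Q = "quot_aug_algebra P J"
  from iso obtain h where "h \<in> aug_iso k A ?Q" unfolding aug_isomorphic_def by blast
  then have h: "h \<in> ring_hom A ?Q" and bij: "bij_betw h (carrier A) (carrier ?Q)"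
    and h_smult: "\<And>c x. \<lbrakk>c \<in> carrier k; x \<in> carrier A\<rbrakk> \<Longrightarrow> h (c \<odot>\<^bsub>A\<^esub> x) = c \<odot>\<^bsub>?Q\<^esub> h x"
    and h_aug: "\<And>x. x \<in> carrier A \<Longrightarrow> aug ?Q (h x) = aug A x"
    by (auto simp: aug_iso_def aug_hom_def)
  define \<phi> where "\<phi> f = inv_into (carrier A) h (J +>\<^bsub>P\<^esub> f)" for f
  have Q: "carrier ?Q = (\<lambda>f. J +>\<^bsub>P\<^esub> f) ` carrier P" by (simp add: quot_simps P.rcosets_eq_image)
  have phi_closed: "\<phi> f \<in> carrier A" and h_phi: "h (\<phi> f) = J +>\<^bsub>P\<^esub> f" if "f \<in> carrier P" for f
    using that bij Q by (auto simp: \<phi>_def bij_betw_def intro!: inv_into_into f_inv_into_f)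
  \<comment> \<open>Injectivity of \<open>h\<close> reduces every law for \<phi> to a law for
    cosets, where the operations are known on representatives.\<close>
  have phi_eqI: "\<phi> f = a" if "f \<in> carrier P" "a \<in> carrier A" "h a = J +>\<^bsub>P\<^esub> f" for f a
    using that bij by (metis \<phi>_def bij_betw_def inv_into_f_f)
  have hom: "\<phi> \<in> ring_hom P A"
  proof (rule ring_hom_memI)
    fix f g assume fg: "f \<in> carrier P" "g \<in> carrier P"
    show "\<phi> (f \<otimes>\<^bsub>P\<^esub> g) = \<phi> f \<otimes>\<^bsub>A\<^esub> \<phi> g"
      using fg ring_hom_mult[OF h phi_closed phi_closed]
      by (intro phi_eqI) (simp_all add: phi_closed h_phi quot_simps J.rcoset_mult_add)
    show "\<phi> (f \<oplus>\<^bsub>P\<^esub> g) = \<phi> f \<oplus>\<^bsub>A\<^esub> \<phi> g"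
      using fg ring_hom_add[OF h phi_closed phi_closed]
      by (intro phi_eqI) (simp_all add: phi_closed h_phi quot_simps J.a_rcos_sum)
  next
    show "\<phi> \<one>\<^bsub>P\<^esub> = \<one>\<^bsub>A\<^esub>"
      using ring_hom_one[OF h] by (intro phi_eqI) (simp_all add: quot_simps)
  qed (simp add: phi_closed)
  moreover have "\<phi> (c \<odot>\<^bsub>P\<^esub> f) = c \<odot>\<^bsub>A\<^esub> \<phi> f" if "c \<in> carrier k" "f \<in> carrier P" for c f
    using that P.smult_rcos[OF J(1) that]
    by (intro phi_eqI) (simp_all add: phi_closed h_smult h_phi quot_simps(12))
  moreover have "aug A (\<phi> f) = aug P f" if "f \<in> carrier P" for f
    using that h_aug[OF phi_closed] P.aug_rcos[OF J] by (metis h_phi)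
  ultimately have phi: "\<phi> \<in> aug_hom k P A" by (simp add: aug_hom_def)
  interpret aug_algebra_hom k P A \<phi> by unfold_locales (rule phi)
  have "\<phi> ` carrier P = carrier A"
  proof
    show "\<phi> ` carrier P \<subseteq> carrier A" using phi_closed by blast
    show "carrier A \<subseteq> \<phi> ` carrier P"
    proof
      fix a assume a: "a \<in> carrier A"
      then have "h a \<in> carrier ?Q" using h by (rule ring_hom_closed[rotated])
      then obtain f where "f \<in> carrier P" "h a = J +>\<^bsub>P\<^esub> f" unfolding Q by blast
      with a phi_eqI show "a \<in> \<phi> ` carrier P" by blast
    qed
  qed
  moreover have "f \<in> a_kernel P A \<phi> \<longleftrightarrow> f \<in> J" if f: "f \<in> carrier P" for f
  proof -
    have "\<zero>\<^bsub>P\<^esub> \<in> carrier P" by simp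
    then have "\<phi> f = \<phi> \<zero>\<^bsub>P\<^esub> \<longleftrightarrow> J +>\<^bsub>P\<^esub> f = J +>\<^bsub>P\<^esub> \<zero>\<^bsub>P\<^esub>"
      using h_phi f by (metis \<phi>_def)
    then show ?thesis using f by (simp add: J.rcos_eq_iff_diff mem_kernel a_minus_def)
  qed
  then have "a_kernel P A \<phi> = J" using J.Icarr by (auto simp: mem_kernel)
  ultimately show thesis using aug_algebra_hom_axioms by (rule that[rotated])
qed

section \<open>The algebra of non-commutative power series\<close>

lemma take_in_lists: "w \<in> lists X \<Longrightarrow> take i w \<in> lists X"
  by (auto dest: in_set_takeD)

lemma drop_in_lists: "w \<in> lists X \<Longrightarrow> drop i w \<in> lists X"
  by (auto dest: in_set_dropD)

locale nc_series = cring k for k :: "('k, 'm) ring_scheme" (structure) +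
  fixes X :: "'x set"
begin

abbreviation P where "P \<equiv> nc_power_series k X"

lemma carrier_series: "carrier P = lists X \<rightarrow>\<^sub>E carrier k"
  by (simp add: nc_power_series_def)

lemma coeff_closed [simp]: "\<lbrakk>f \<in> carrier P; w \<in> lists X\<rbrakk> \<Longrightarrow> f w \<in> carrier k"
  unfolding carrier_series by (rule PiE_mem)

lemma seriesI:
  assumes "\<And>w. w \<in> lists X \<Longrightarrow> f w \<in> carrier k"
  shows "(\<lambda>w\<in>lists X. f w) \<in> carrier P"
  unfolding carrier_series restrict_PiE_iff using assms by (rule ballI)

lemma series_eqI:
  assumes "f \<in> carrier P" "g \<in> carrier P" "\<And>w. w \<in> lists X \<Longrightarrow> f w = g w"
  shows "f = g"
  using assms unfolding carrier_series by (rule PiE_ext)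

lemma coeff_simps [simp]:
  assumes "w \<in> lists X"
  shows "(f \<oplus>\<^bsub>P\<^esub> g) w = f w \<oplus> g w" "\<zero>\<^bsub>P\<^esub> w = \<zero>"
    "\<one>\<^bsub>P\<^esub> w = (if w = [] then \<one> else \<zero>)" "(c \<odot>\<^bsub>P\<^esub> f) w = c \<otimes> f w"
  using assms by (simp_all add: nc_power_series_def)

lemma aug_series: "aug P f = f []"
  by (simp add: nc_power_series_def)

lemma coeff_mult:
  "w \<in> lists X \<Longrightarrow> (f \<otimes>\<^bsub>P\<^esub> g) w = (\<Oplus>i\<in>{..length w}. f (take i w) \<otimes> g (drop i w))"
  by (simp add: nc_power_series_def)

lemma coeff_mult_Nil [simp]:
  "\<lbrakk>f \<in> carrier P; g \<in> carrier P\<rbrakk> \<Longrightarrow> (f \<otimes>\<^bsub>P\<^esub> g) [] = f [] \<otimes> g []"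
  by (simp add: coeff_mult)

lemma series_closed:
  shows "\<lbrakk>f \<in> carrier P; g \<in> carrier P\<rbrakk> \<Longrightarrow> f \<oplus>\<^bsub>P\<^esub> g \<in> carrier P"
    and "\<zero>\<^bsub>P\<^esub> \<in> carrier P" and "\<one>\<^bsub>P\<^esub> \<in> carrier P"
    and "\<lbrakk>c \<in> carrier k; f \<in> carrier P\<rbrakk> \<Longrightarrow> c \<odot>\<^bsub>P\<^esub> f \<in> carrier P"
    and "\<lbrakk>f \<in> carrier P; g \<in> carrier P\<rbrakk> \<Longrightarrow> f \<otimes>\<^bsub>P\<^esub> g \<in> carrier P"
proof -
  have "f \<oplus>\<^bsub>P\<^esub> g = (\<lambda>w\<in>lists X. f w \<oplus> g w)" "\<zero>\<^bsub>P\<^esub> = (\<lambda>w\<in>lists X. \<zero>)"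
    "\<one>\<^bsub>P\<^esub> = (\<lambda>w\<in>lists X. if w = [] then \<one> else \<zero>)"
    "c \<odot>\<^bsub>P\<^esub> f = (\<lambda>w\<in>lists X. c \<otimes> f w)"
    "f \<otimes>\<^bsub>P\<^esub> g = (\<lambda>w\<in>lists X. \<Oplus>i\<in>{..length w}. f (take i w) \<otimes> g (drop i w))"
    by (simp_all add: nc_power_series_def)
  note eqs = this
  show "\<lbrakk>f \<in> carrier P; g \<in> carrier P\<rbrakk> \<Longrightarrow> f \<oplus>\<^bsub>P\<^esub> g \<in> carrier P"
    unfolding eqs by (rule seriesI) simp
  show "\<zero>\<^bsub>P\<^esub> \<in> carrier P" unfolding eqs by (rule seriesI) simp
  show "\<one>\<^bsub>P\<^esub> \<in> carrier P" unfolding eqs by (rule seriesI) simp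
  show "\<lbrakk>c \<in> carrier k; f \<in> carrier P\<rbrakk> \<Longrightarrow> c \<odot>\<^bsub>P\<^esub> f \<in> carrier P"
    unfolding eqs by (rule seriesI) simp
  show "\<lbrakk>f \<in> carrier P; g \<in> carrier P\<rbrakk> \<Longrightarrow> f \<otimes>\<^bsub>P\<^esub> g \<in> carrier P"
    unfolding eqs
    by (intro seriesI finsum_closed funcsetI m_closed coeff_closed take_in_lists drop_in_lists)
qed

text \<open>The right quotient of a series by a letter: for \<open>x\<close> in \<open>X\<close> it
  undoes right multiplication by that letter and lowers the order of a series by at most
  one.\<close>

definition shift :: "'x \<Rightarrow> ('x list \<Rightarrow> 'k) \<Rightarrow> 'x list \<Rightarrow> 'k"
  where "shift x f = (\<lambda>w\<in>lists X. f (w @ [x]))"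

lemma shift_closed [simp]: "\<lbrakk>x \<in> X; f \<in> carrier P\<rbrakk> \<Longrightarrow> shift x f \<in> carrier P"
  unfolding shift_def by (rule seriesI) simp

lemma coeff_shift [simp]: "w \<in> lists X \<Longrightarrow> shift x f w = f (w @ [x])"
  by (simp add: shift_def)

lemma lists_induct [consumes 1, case_names Nil snoc]:
  assumes "w \<in> lists X" "Q []" "\<And>w x. \<lbrakk>w \<in> lists X; x \<in> X; Q w\<rbrakk> \<Longrightarrow> Q (w @ [x])"
  shows "Q w"
  using assms(1) by (induction w rule: rev_induct) (auto intro: assms)

text \<open>Of the cuts of \<open>w @ [x]\<close>, only the one after the last letter leaves
  \<open>x\<close> to \<open>f\<close>; every other cut leaves \<open>x\<close> at the end of the
  word read by \<open>g\<close>.\<close>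

lemma coeff_mult_snoc:
  assumes "f \<in> carrier P" "g \<in> carrier P" "w \<in> lists X" "x \<in> X"
  shows "(f \<otimes>\<^bsub>P\<^esub> g) (w @ [x]) = (f \<otimes>\<^bsub>P\<^esub> shift x g) w \<oplus> f (w @ [x]) \<otimes> g []"
proof -
  let ?v = "w @ [x]"
  have v: "?v \<in> lists X" using assms by simp
  have summand: "f (take i ?v) \<otimes> g (drop i ?v) \<in> carrier k" for i
    using assms(1,2) take_in_lists[OF v] drop_in_lists[OF v] by (intro m_closed coeff_closed)
  have "(f \<otimes>\<^bsub>P\<^esub> g) ?v
      = f ?v \<otimes> g [] \<oplus> (\<Oplus>i\<in>{..length w}. f (take i ?v) \<otimes> g (drop i ?v))"
    using finsum_Suc[of "\<lambda>i. f (take i ?v) \<otimes> g (drop i ?v)" "length w"] summand v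
    by (simp add: coeff_mult Pi_def del: take_append drop_append)
  also have "(\<Oplus>i\<in>{..length w}. f (take i ?v) \<otimes> g (drop i ?v))
      = (\<Oplus>i\<in>{..length w}. f (take i w) \<otimes> shift x g (drop i w))"
  proof (rule finsum_cong'[OF refl])
    show "(\<lambda>i. f (take i w) \<otimes> shift x g (drop i w)) \<in> {..length w} \<rightarrow> carrier k"
      by (intro funcsetI m_closed coeff_closed shift_closed take_in_lists drop_in_lists assms)
    show "f (take i ?v) \<otimes> g (drop i ?v) = f (take i w) \<otimes> shift x g (drop i w)"
      if "i \<in> {..length w}" for i
      using that drop_in_lists[OF assms(3)] by simp
  qed
  also have "\<dots> = (f \<otimes>\<^bsub>P\<^esub> shift x g) w" using assms(3) by (simp add: coeff_mult)
  finally show ?thesis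
    using assms v by (simp add: a_comm series_closed)
qed

text \<open>Commutativity of \<open>k\<close> enters here: the constant coefficient of
  \<open>g\<close> stands on the right in the coefficient formula and acts as a scalar from the
  left.\<close>

lemma shift_mult:
  assumes "f \<in> carrier P" "g \<in> carrier P" "x \<in> X"
  shows "shift x (f \<otimes>\<^bsub>P\<^esub> g) = f \<otimes>\<^bsub>P\<^esub> shift x g \<oplus>\<^bsub>P\<^esub> g [] \<odot>\<^bsub>P\<^esub> shift x f"
  using assms
  by (intro series_eqI) (simp_all add: series_closed coeff_mult_snoc m_comm)

section \<open>Algebra laws for power series\<close>

lemma series_distr:
  assumes "f \<in> carrier P" "g \<in> carrier P" "h \<in> carrier P"
  shows "(f \<oplus>\<^bsub>P\<^esub> g) \<otimes>\<^bsub>P\<^esub> h = f \<otimes>\<^bsub>P\<^esub> h \<oplus>\<^bsub>P\<^esub> g \<otimes>\<^bsub>P\<^esub> h"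
    and "h \<otimes>\<^bsub>P\<^esub> (f \<oplus>\<^bsub>P\<^esub> g) = h \<otimes>\<^bsub>P\<^esub> f \<oplus>\<^bsub>P\<^esub> h \<otimes>\<^bsub>P\<^esub> g"
proof -
  have "((f \<oplus>\<^bsub>P\<^esub> g) \<otimes>\<^bsub>P\<^esub> h) w = (f \<otimes>\<^bsub>P\<^esub> h \<oplus>\<^bsub>P\<^esub> g \<otimes>\<^bsub>P\<^esub> h) w
    \<and> (h \<otimes>\<^bsub>P\<^esub> (f \<oplus>\<^bsub>P\<^esub> g)) w = (h \<otimes>\<^bsub>P\<^esub> f \<oplus>\<^bsub>P\<^esub> h \<otimes>\<^bsub>P\<^esub> g) w" if w: "w \<in> lists X" for w
  proof -
    have tk: "\<And>i. take i w \<in> lists X" "\<And>i. drop i w \<in> lists X"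
      by (rule take_in_lists[OF w], rule drop_in_lists[OF w])
    have cl: "u (take i w) \<in> carrier k" "u (drop i w) \<in> carrier k" if "u \<in> {f, g, h}" for u i
    proof -
      have u: "u \<in> carrier P" using that assms by auto
      show "u (take i w) \<in> carrier k" "u (drop i w) \<in> carrier k"
        by (rule coeff_closed[OF u tk(1)], rule coeff_closed[OF u tk(2)])
    qed
    have "(\<Oplus>i\<in>{..length w}. (f \<oplus>\<^bsub>P\<^esub> g) (take i w) \<otimes> h (drop i w))
        = (\<Oplus>i\<in>{..length w}. f (take i w) \<otimes> h (drop i w) \<oplus> g (take i w) \<otimes> h (drop i w))"
      "(\<Oplus>i\<in>{..length w}. h (take i w) \<otimes> (f \<oplus>\<^bsub>P\<^esub> g) (drop i w))
        = (\<Oplus>i\<in>{..length w}. h (take i w) \<otimes> f (drop i w) \<oplus> h (take i w) \<otimes> g (drop i w))"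
      by (intro finsum_cong' funcsetI refl; simp add: tk cl l_distr r_distr)+
    then show ?thesis
      using w by (simp add: coeff_mult finsum_addf cl Pi_def)
  qed
  then show "(f \<oplus>\<^bsub>P\<^esub> g) \<otimes>\<^bsub>P\<^esub> h = f \<otimes>\<^bsub>P\<^esub> h \<oplus>\<^bsub>P\<^esub> g \<otimes>\<^bsub>P\<^esub> h"
    "h \<otimes>\<^bsub>P\<^esub> (f \<oplus>\<^bsub>P\<^esub> g) = h \<otimes>\<^bsub>P\<^esub> f \<oplus>\<^bsub>P\<^esub> h \<otimes>\<^bsub>P\<^esub> g"
    using assms by (intro series_eqI; simp add: series_closed)+
qed

lemma series_smult_mult:
  assumes "c \<in> carrier k" "f \<in> carrier P" "g \<in> carrier P"
  shows "(c \<odot>\<^bsub>P\<^esub> f) \<otimes>\<^bsub>P\<^esub> g = c \<odot>\<^bsub>P\<^esub> (f \<otimes>\<^bsub>P\<^esub> g)"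
    and "f \<otimes>\<^bsub>P\<^esub> (c \<odot>\<^bsub>P\<^esub> g) = c \<odot>\<^bsub>P\<^esub> (f \<otimes>\<^bsub>P\<^esub> g)"
proof -
  have "((c \<odot>\<^bsub>P\<^esub> f) \<otimes>\<^bsub>P\<^esub> g) w = (c \<odot>\<^bsub>P\<^esub> (f \<otimes>\<^bsub>P\<^esub> g)) w
    \<and> (f \<otimes>\<^bsub>P\<^esub> (c \<odot>\<^bsub>P\<^esub> g)) w = (c \<odot>\<^bsub>P\<^esub> (f \<otimes>\<^bsub>P\<^esub> g)) w" if w: "w \<in> lists X" for w
  proof -
    have tk: "\<And>i. take i w \<in> lists X" "\<And>i. drop i w \<in> lists X"
      by (rule take_in_lists[OF w], rule drop_in_lists[OF w])
    have cl: "u (take i w) \<in> carrier k" "u (drop i w) \<in> carrier k" if "u \<in> {f, g}" for u i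
    proof -
      have u: "u \<in> carrier P" using that assms by auto
      show "u (take i w) \<in> carrier k" "u (drop i w) \<in> carrier k"
        by (rule coeff_closed[OF u tk(1)], rule coeff_closed[OF u tk(2)])
    qed
    have "(\<Oplus>i\<in>{..length w}. (c \<odot>\<^bsub>P\<^esub> f) (take i w) \<otimes> g (drop i w))
        = (\<Oplus>i\<in>{..length w}. c \<otimes> (f (take i w) \<otimes> g (drop i w)))"
      "(\<Oplus>i\<in>{..length w}. f (take i w) \<otimes> (c \<odot>\<^bsub>P\<^esub> g) (drop i w))
        = (\<Oplus>i\<in>{..length w}. c \<otimes> (f (take i w) \<otimes> g (drop i w)))"
      by (intro finsum_cong' funcsetI refl; simp add: tk cl assms(1) m_assoc m_lcomm)+
    then show ?thesis
      using w assms(1) by (simp add: coeff_mult finsum_rdistr cl Pi_def)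
  qed
  then show "(c \<odot>\<^bsub>P\<^esub> f) \<otimes>\<^bsub>P\<^esub> g = c \<odot>\<^bsub>P\<^esub> (f \<otimes>\<^bsub>P\<^esub> g)"
    "f \<otimes>\<^bsub>P\<^esub> (c \<odot>\<^bsub>P\<^esub> g) = c \<odot>\<^bsub>P\<^esub> (f \<otimes>\<^bsub>P\<^esub> g)"
    using assms by (intro series_eqI; simp add: series_closed)+
qed

lemma series_one_mult:
  assumes "f \<in> carrier P"
  shows "\<one>\<^bsub>P\<^esub> \<otimes>\<^bsub>P\<^esub> f = f" and "f \<otimes>\<^bsub>P\<^esub> \<one>\<^bsub>P\<^esub> = f"
proof -
  \<comment> \<open>The series stays arbitrary in the induction because the step passes from
    \<open>f\<close> to \<open>shift x f\<close>.\<close>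
  have "(\<one>\<^bsub>P\<^esub> \<otimes>\<^bsub>P\<^esub> f) w = f w" if "w \<in> lists X" for w
    using that assms
  proof (induction w arbitrary: f rule: lists_induct)
    case (snoc w x)
    then show ?case by (simp add: coeff_mult_snoc series_closed)
  qed (simp add: series_closed)
  then show "\<one>\<^bsub>P\<^esub> \<otimes>\<^bsub>P\<^esub> f = f" using assms by (intro series_eqI) (simp_all add: series_closed)
  have "(f \<otimes>\<^bsub>P\<^esub> \<one>\<^bsub>P\<^esub>) w = f w" if "w \<in> lists X" for w
    using that
  proof (cases w rule: rev_cases)
    case (snoc v x)
    with that have v: "v \<in> lists X" "x \<in> X" by auto
    \<comment> \<open>Stripping a letter from the unit leaves zero, so on a nonempty word only the
      cut at its end contributes and no induction is involved.\<close>
    have "(f \<otimes>\<^bsub>P\<^esub> shift x \<one>\<^bsub>P\<^esub>) v = \<zero>"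
    proof -
      have "f (take i v) \<otimes> shift x \<one>\<^bsub>P\<^esub> (drop i v) = \<zero>" for i
        using v assms take_in_lists[OF v(1)] drop_in_lists[OF v(1)]
        by (simp del: in_lists_conv_set add: coeff_simps)
      then show ?thesis using v by (simp add: coeff_mult)
    qed
    with v snoc assms show ?thesis by (simp add: coeff_mult_snoc series_closed)
  qed (use assms in \<open>simp add: series_closed\<close>)
  then show "f \<otimes>\<^bsub>P\<^esub> \<one>\<^bsub>P\<^esub> = f" using assms by (intro series_eqI) (simp_all add: series_closed)
qed

lemma series_add_assoc:
  assumes "f \<in> carrier P" "g \<in> carrier P" "h \<in> carrier P"
  shows "f \<oplus>\<^bsub>P\<^esub> g \<oplus>\<^bsub>P\<^esub> h = f \<oplus>\<^bsub>P\<^esub> (g \<oplus>\<^bsub>P\<^esub> h)"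
  using assms by (intro series_eqI) (simp_all add: series_closed a_assoc)

text \<open>Comparing coefficients at a word \<open>w @ [x]\<close> reduces the claim for \<open>h\<close> to the one for
  \<open>shift x h\<close> at \<open>w\<close>, so no double sum has to be rearranged.\<close>

lemma series_mult_assoc:
  assumes "f \<in> carrier P" "g \<in> carrier P" "h \<in> carrier P"
  shows "f \<otimes>\<^bsub>P\<^esub> g \<otimes>\<^bsub>P\<^esub> h = f \<otimes>\<^bsub>P\<^esub> (g \<otimes>\<^bsub>P\<^esub> h)"
proof -
  have "(f \<otimes>\<^bsub>P\<^esub> g \<otimes>\<^bsub>P\<^esub> h) w = (f \<otimes>\<^bsub>P\<^esub> (g \<otimes>\<^bsub>P\<^esub> h)) w" if "w \<in> lists X" for w
    using that assms(3)
  proof (induction w arbitrary: h rule: lists_induct)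
    case Nil
    then show ?case using assms by (simp add: series_closed m_assoc)
  next
    case (snoc w x)
    note cl = assms(1,2) snoc.prems shift_closed[OF snoc.hyps(2)] series_closed
    have w: "w @ [x] \<in> lists X" using snoc.hyps by simp
    have "(f \<otimes>\<^bsub>P\<^esub> g \<otimes>\<^bsub>P\<^esub> h) (w @ [x])
        = (f \<otimes>\<^bsub>P\<^esub> g \<otimes>\<^bsub>P\<^esub> shift x h) w \<oplus> (f \<otimes>\<^bsub>P\<^esub> g) (w @ [x]) \<otimes> h []"
      using snoc.hyps by (simp add: coeff_mult_snoc cl)
    also have "\<dots> = (f \<otimes>\<^bsub>P\<^esub> (g \<otimes>\<^bsub>P\<^esub> shift x h)) w
        \<oplus> ((f \<otimes>\<^bsub>P\<^esub> shift x g) w \<oplus> f (w @ [x]) \<otimes> g []) \<otimes> h []"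
      using snoc.hyps snoc.IH[OF shift_closed[OF snoc.hyps(2) snoc.prems]]
      by (simp add: coeff_mult_snoc cl)
    also have "\<dots> = ((f \<otimes>\<^bsub>P\<^esub> (g \<otimes>\<^bsub>P\<^esub> shift x h)) w \<oplus> h [] \<otimes> (f \<otimes>\<^bsub>P\<^esub> shift x g) w)
        \<oplus> f (w @ [x]) \<otimes> (g [] \<otimes> h [])"
    proof -
      have "p \<oplus> (q \<oplus> c \<otimes> d) \<otimes> e = (p \<oplus> e \<otimes> q) \<oplus> c \<otimes> (d \<otimes> e)"
        if "p \<in> carrier k" "q \<in> carrier k" "c \<in> carrier k" "d \<in> carrier k" "e \<in> carrier k"
        for p q c d e
        using that by algebra
      then show ?thesis
        using coeff_closed[OF _ snoc.hyps(1)] coeff_closed[OF _ w] coeff_closed[of _ "[]"] cl by simp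
    qed
    also have "\<dots> = (f \<otimes>\<^bsub>P\<^esub> shift x (g \<otimes>\<^bsub>P\<^esub> h)) w \<oplus> f (w @ [x]) \<otimes> (g [] \<otimes> h [])"
      using snoc.hyps coeff_closed[of _ "[]"]
      by (simp add: shift_mult series_distr series_smult_mult cl)
    also have "\<dots> = (f \<otimes>\<^bsub>P\<^esub> (g \<otimes>\<^bsub>P\<^esub> h)) (w @ [x])"
      using snoc.hyps by (simp add: coeff_mult_snoc cl)
    finally show ?case .
  qed
  then show ?thesis using assms by (intro series_eqI) (simp_all add: series_closed)
qed

lemma abelian_group_series: "abelian_group P"
proof (rule abelian_groupI)
  fix f assume f: "f \<in> carrier P"
  show "\<exists>g\<in>carrier P. g \<oplus>\<^bsub>P\<^esub> f = \<zero>\<^bsub>P\<^esub>"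
  proof
    show "(\<lambda>w\<in>lists X. \<ominus> f w) \<in> carrier P" using f by (intro seriesI) simp
    then show "(\<lambda>w\<in>lists X. \<ominus> f w) \<oplus>\<^bsub>P\<^esub> f = \<zero>\<^bsub>P\<^esub>"
      using f by (intro series_eqI) (simp_all add: series_closed l_neg)
  qed
  show "\<zero>\<^bsub>P\<^esub> \<oplus>\<^bsub>P\<^esub> f = f" using f by (intro series_eqI) (simp_all add: series_closed)
next
  fix f g assume "f \<in> carrier P" "g \<in> carrier P"
  then show "f \<oplus>\<^bsub>P\<^esub> g = g \<oplus>\<^bsub>P\<^esub> f" by (intro series_eqI) (simp_all add: series_closed a_comm)
qed (simp_all add: series_closed series_add_assoc)

lemma ring_series: "ring P"
  by (intro ringI abelian_group_series monoidI)
    (simp_all add: series_closed series_mult_assoc series_one_mult series_distr)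

lemma module_series: "module k P"
proof (rule moduleI)
  fix a b f g assume *: "a \<in> carrier k" "b \<in> carrier k" "f \<in> carrier P" "g \<in> carrier P"
  show "(a \<oplus> b) \<odot>\<^bsub>P\<^esub> f = a \<odot>\<^bsub>P\<^esub> f \<oplus>\<^bsub>P\<^esub> b \<odot>\<^bsub>P\<^esub> f"
    using * by (intro series_eqI) (simp_all add: series_closed l_distr)
  show "a \<odot>\<^bsub>P\<^esub> (f \<oplus>\<^bsub>P\<^esub> g) = a \<odot>\<^bsub>P\<^esub> f \<oplus>\<^bsub>P\<^esub> a \<odot>\<^bsub>P\<^esub> g"
    using * by (intro series_eqI) (simp_all add: series_closed r_distr)
  show "(a \<otimes> b) \<odot>\<^bsub>P\<^esub> f = a \<odot>\<^bsub>P\<^esub> (b \<odot>\<^bsub>P\<^esub> f)"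
    using * by (intro series_eqI) (simp_all add: series_closed m_assoc)
next
  fix f assume "f \<in> carrier P"
  then show "\<one> \<odot>\<^bsub>P\<^esub> f = f" by (intro series_eqI) (simp_all add: series_closed)
qed (simp_all add: series_closed abelian_group_series is_cring)


sublocale P: augmented_algebra k P
proof (intro augmented_algebra.intro module_series ring_series augmented_algebra_axioms.intro)
  show "aug P \<in> ring_hom P k"
    by (rule ring_hom_memI) (simp_all add: aug_series series_closed)
qed (simp_all add: series_smult_mult aug_series)

text \<open>The additive inverse of \<open>P\<close> comes from the abstract group structure,
  without a coefficient formula; the coefficients are instead solved for from f = (f - g) +
  g.\<close>

lemma coeff_diff [simp]:
  assumes "f \<in> carrier P" "g \<in> carrier P" "w \<in> lists X"
  shows "(f \<ominus>\<^bsub>P\<^esub> g) w = f w \<ominus> g w"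
proof -
  have "f \<ominus>\<^bsub>P\<^esub> g \<in> carrier P" "f = (f \<ominus>\<^bsub>P\<^esub> g) \<oplus>\<^bsub>P\<^esub> g"
    using assms by (simp_all add: a_minus_def P.M.a_assoc P.M.l_neg)
  then have "f w = (f \<ominus>\<^bsub>P\<^esub> g) w \<oplus> g w" "(f \<ominus>\<^bsub>P\<^esub> g) w \<in> carrier k"
    using coeff_simps(1)[OF assms(3), of "f \<ominus>\<^bsub>P\<^esub> g" g] assms coeff_closed by auto
  moreover have "p = (p \<oplus> q) \<ominus> q" if "p \<in> carrier k" "q \<in> carrier k" for p q
    using that by algebra
  ultimately show ?thesis using assms coeff_closed by metis
qed

lemma coeff_finsum:
  assumes "F \<in> S \<rightarrow> carrier P" "w \<in> lists X"
  shows "(\<Oplus>\<^bsub>P\<^esub>s\<in>S. F s) w = (\<Oplus>s\<in>S. F s w)"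
  using assms(1)
proof (induction S rule: infinite_finite_induct)
  case (insert s S)
  then have "F \<in> S \<rightarrow> carrier P" "F s \<in> carrier P" by auto
  moreover from this have "(\<lambda>s. F s w) \<in> S \<rightarrow> carrier k" "F s w \<in> carrier k"
    using assms(2) by (simp_all add: Pi_iff)
  ultimately show ?case using insert assms(2) by simp
qed (use assms(2) in simp_all)

section \<open>Indeterminates, order of a series, and powers of the augmentation ideal\<close>

definition var :: "'x \<Rightarrow> 'x list \<Rightarrow> 'k"
  where "var x = (\<lambda>w\<in>lists X. if w = [x] then \<one> else \<zero>)"

lemma var_closed [simp]: "var x \<in> carrier P"
  unfolding var_def by (rule seriesI) simp

lemma coeff_var: "w \<in> lists X \<Longrightarrow> var x w = (if w = [x] then \<one> else \<zero>)"
  by (simp add: var_def)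

lemma shift_var: "z \<in> X \<Longrightarrow> shift z (var x) = (if z = x then \<one>\<^bsub>P\<^esub> else \<zero>\<^bsub>P\<^esub>)"
  by (rule series_eqI) (simp_all add: coeff_var series_closed)

lemma coeff_mult_var:
  assumes "g \<in> carrier P" "w \<in> lists X" "z \<in> X"
  shows "(g \<otimes>\<^bsub>P\<^esub> var x) (w @ [z]) = (if z = x then g w else \<zero>)"
  using assms by (simp add: coeff_mult_snoc shift_var coeff_var)

text \<open>Every nonempty word ends in exactly one letter, so its coefficient comes from a single
  summand. Finiteness of \<open>X\<close> makes the right-hand side a genuine sum; over an infinite
  set a \<open>finsum\<close> is zero by convention.\<close>

lemma series_decomposition:
  assumes "finite X" "f \<in> carrier P" "f [] = \<zero>"
  shows "f = (\<Oplus>\<^bsub>P\<^esub>x\<in>X. shift x f \<otimes>\<^bsub>P\<^esub> var x)"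
proof (rule series_eqI)
  have F: "(\<lambda>x. shift x f \<otimes>\<^bsub>P\<^esub> var x) \<in> X \<rightarrow> carrier P" using assms by auto
  then show "(\<Oplus>\<^bsub>P\<^esub>x\<in>X. shift x f \<otimes>\<^bsub>P\<^esub> var x) \<in> carrier P" by (rule P.M.finsum_closed)
  fix w assume "w \<in> lists X"
  then show "f w = (\<Oplus>\<^bsub>P\<^esub>x\<in>X. shift x f \<otimes>\<^bsub>P\<^esub> var x) w"
  proof (cases w rule: rev_cases)
    case Nil
    have "(\<Oplus>x\<in>X. (shift x f \<otimes>\<^bsub>P\<^esub> var x) []) = (\<Oplus>x\<in>X. \<zero>)"
      using assms by (intro finsum_cong') (auto simp: coeff_var)
    then show ?thesis using Nil assms(3) coeff_finsum[OF F, of "[]"] by simp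
  next
    case (snoc v z)
    with \<open>w \<in> lists X\<close> have v: "v \<in> lists X" "z \<in> X" by auto
    have "(\<Oplus>x\<in>X. (shift x f \<otimes>\<^bsub>P\<^esub> var x) (v @ [z])) = (\<Oplus>x\<in>X. if z = x then f (v @ [x]) else \<zero>)"
      using assms v by (intro finsum_cong' funcsetI refl) (simp_all add: coeff_mult_var)
    also have "\<dots> = f (v @ [z])"
      using finsum_singleton[of z X "\<lambda>x. f (v @ [x])"] assms v by (simp add: Pi_iff)
    finally show ?thesis using snoc v coeff_finsum[OF F, of w] by simp
  qed
qed (rule assms)

text \<open>The series of order at least \<open>n\<close>. Being a condition on single coefficients,
  it passes to coefficientwise limits.\<close>

definition vanishing_below :: "nat \<Rightarrow> ('x list \<Rightarrow> 'k) set"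
  where "vanishing_below n = {f \<in> carrier P. \<forall>w\<in>lists X. length w < n \<longrightarrow> f w = \<zero>}"

lemma mem_aug_ideal_series: "f \<in> aug_ideal k P \<longleftrightarrow> f \<in> carrier P \<and> f [] = \<zero>"
  by (simp add: P.mem_aug_ideal aug_series)

lemma mult_vanishing_below:
  assumes "f \<in> vanishing_below m" "g \<in> carrier P" "g [] = \<zero>"
  shows "f \<otimes>\<^bsub>P\<^esub> g \<in> vanishing_below (Suc m)"
proof -
  have f: "f \<in> carrier P" "\<And>w. \<lbrakk>w \<in> lists X; length w < m\<rbrakk> \<Longrightarrow> f w = \<zero>"
    using assms(1) by (auto simp: vanishing_below_def)
  have "(f \<otimes>\<^bsub>P\<^esub> g) w = \<zero>" if w: "w \<in> lists X" "length w < Suc m" for w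
  proof -
    have "f (take i w) \<otimes> g (drop i w) = \<zero>" if "i \<le> length w" for i
    proof -
      have tk: "f (take i w) \<in> carrier k" "g (drop i w) \<in> carrier k"
        by (rule coeff_closed[OF f(1) take_in_lists[OF w(1)]],
          rule coeff_closed[OF assms(2) drop_in_lists[OF w(1)]])
      show ?thesis
      proof (cases "i < m")
        case True
        then have "f (take i w) = \<zero>" using f(2)[OF take_in_lists[OF w(1)]] by simp
        with tk show ?thesis by simp
      next
        case False
        \<comment> \<open>Here \<open>m \<le> i\<close> and \<open>length w \<le> m\<close>, so the
          cut is at the end of \<open>w\<close> and \<open>g\<close> contributes its constant
          coefficient.\<close>
        with that w have "drop i w = []" by simp
        with tk assms(3) show ?thesis by simp
      qed
    qed
    then show ?thesis using w finsum_cong'[of "{..length w}" "{..length w}" "\<lambda>_. \<zero>"]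
      by (simp add: coeff_mult)
  qed
  with f assms show ?thesis by (simp add: vanishing_below_def)
qed

text \<open>A factor without constant coefficient raises the order by at least one, which gives one
  inclusion. For the other, stripping the last letter turns order n + 1 into order n, and the
  decomposition by last letters is a finite sum of products with letters, which lie in the
  augmentation ideal.\<close>

lemma aug_power_series:
  assumes "finite X"
  shows "P.aug_power n = vanishing_below n"
proof (induction n)
  case (Suc n)
  have "f \<in> vanishing_below (Suc n)" if "f \<in> ideal_prod P (vanishing_below n) (aug_ideal k P)" for f
    using that
  proof induction
    case (prod i j)
    then show ?case using mult_vanishing_below by (simp add: mem_aug_ideal_series)
  next
    case (sum s t)
    then show ?case by (simp add: vanishing_below_def)
  qed
  moreover have "f \<in> P.aug_power (Suc n)" if f: "f \<in> vanishing_below (Suc n)" for f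
  proof -
    have fP: "f \<in> carrier P" and f0: "f [] = \<zero>" using f by (simp_all add: vanishing_below_def)
    have "shift x f \<otimes>\<^bsub>P\<^esub> var x \<in> P.aug_power (Suc n)" if "x \<in> X" for x
    proof -
      have "shift x f \<in> P.aug_power n"
        using f that Suc by (simp add: vanishing_below_def)
      moreover have "var x \<in> aug_ideal k P"
        by (simp add: mem_aug_ideal_series coeff_var)
      ultimately show ?thesis by (simp add: ideal_power.simps(2) ideal_prod.prod)
    qed
    then have "(\<Oplus>\<^bsub>P\<^esub>x\<in>X. shift x f \<otimes>\<^bsub>P\<^esub> var x) \<in> P.aug_power (Suc n)"
      by (intro ideal.finsum_in_ideal[OF P.ideal_aug_power] funcsetI)
    then show ?thesis using series_decomposition[OF assms fP f0] by metis
  qed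
  ultimately show ?case using Suc by (auto simp: ideal_power.simps(2))
qed (simp add: vanishing_below_def)

lemma adic_cauchy_complete_series:
  assumes "finite X"
  shows "P.adic_cauchy_complete"
  unfolding P.adic_cauchy_complete_def aug_power_series[OF assms]
proof (intro allI impI)
  fix s assume s: "\<forall>n. s n \<in> carrier P \<and> s (Suc n) \<ominus>\<^bsub>P\<^esub> s n \<in> vanishing_below n"
  then have sP: "s n \<in> carrier P" for n by blast
  have step: "s (Suc n) w = s n w" if "w \<in> lists X" "length w < n" for n w
  proof -
    have "(s (Suc n) \<ominus>\<^bsub>P\<^esub> s n) w = \<zero>" using s that unfolding vanishing_below_def by blast
    with that sP show ?thesis by (simp add: diff_eq_zero_iff)
  qed
  \<comment> \<open>The difference of \<open>s (Suc n)\<close> and \<open>s n\<close> is controlled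
    only on words shorter than \<open>n\<close>; the coefficient at \<open>w\<close> is therefore
    constant from index \<open>Suc (length w)\<close> on, and the limit reads it off there.\<close>
  have stable: "s n w = s (Suc (length w)) w" if "w \<in> lists X" "length w < n" for n w
    using Suc_leI[OF that(2)]
    by (induction n rule: dec_induct) (use that(1) in \<open>auto simp: step\<close>)
  define f where "f = (\<lambda>w\<in>lists X. s (Suc (length w)) w)"
  have f: "f \<in> carrier P" unfolding f_def using sP by (intro seriesI) simp
  have "f \<ominus>\<^bsub>P\<^esub> s n \<in> vanishing_below n" for n
  proof -
    have "(f \<ominus>\<^bsub>P\<^esub> s n) w = \<zero>" if "w \<in> lists X" "length w < n" for w
      using that f sP stable[OF that] by (simp add: diff_eq_zero_iff f_def)
    then show ?thesis using f sP by (simp add: vanishing_below_def)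
  qed
  with f show "\<exists>f\<in>carrier P. \<forall>n. f \<ominus>\<^bsub>P\<^esub> s n \<in> vanishing_below n" by blast
qed

end

section \<open>Evaluation of power series\<close>

context aug_algebra_hom
begin

text \<open>Generation in degree one propagates to all degrees, because \<open>I^n\<close> consists
  of sums of \<open>n\<close>-fold products from \<open>I\<close>. The preimages are only
  approximate, but the error lies one power deeper than \<open>a\<close>.\<close>

lemma lift_aug_power:
  assumes gen: "\<And>j. j \<in> aug_ideal k A \<Longrightarrow> \<exists>g\<in>aug_ideal k P. j \<ominus>\<^bsub>A\<^esub> \<phi> g \<in> A.aug_power 2"
    and "a \<in> A.aug_power n"
  shows "\<exists>f\<in>P.aug_power n. a \<ominus>\<^bsub>A\<^esub> \<phi> f \<in> A.aug_power (Suc n)"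
  using assms(2)
proof (induction n arbitrary: a)
  case 0
  then have a: "a \<in> carrier A" by simp
  \<comment> \<open>As a module \<open>A\<close> is the sum of \<open>k\<close> times the unit and
    \<open>I\<close>: subtracting the constant \<open>aug A a\<close> leaves an element of the
    augmentation ideal.\<close>
  let ?f = "aug A a \<odot>\<^bsub>P\<^esub> \<one>\<^bsub>P\<^esub>"
  have f: "?f \<in> carrier P" using a by simp
  moreover have "a \<ominus>\<^bsub>A\<^esub> \<phi> ?f \<in> aug_ideal k A"
    using a f by (simp add: A.mem_aug_ideal A.aug_diff aug_hom_apply P.aug_smult P.R.diff_eq_zero_iff)
  ultimately show ?case unfolding A.aug_power_1 by (intro bexI[of _ ?f]) simp_all
next
  case (Suc n)
  interpret J: ideal "A.aug_power (Suc (Suc n))" A by (rule A.ideal_aug_power)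
  note A_carr = ideal.Icarr[OF A.ideal_aug_power] ideal.Icarr[OF A.ideal_aug_ideal]
  note P_carr = ideal.Icarr[OF P.ideal_aug_power] ideal.Icarr[OF P.ideal_aug_ideal]
  from Suc.prems have "a \<in> ideal_prod A (A.aug_power n) (aug_ideal k A)"
    by (simp add: ideal_power.simps(2))
  then show ?case
  proof induction
    case (prod i j)
    from Suc.IH[OF prod(1)] obtain f
      where f: "f \<in> P.aug_power n" "i \<ominus>\<^bsub>A\<^esub> \<phi> f \<in> A.aug_power (Suc n)" by blast
    from gen[OF prod(2)] obtain g
      where g: "g \<in> aug_ideal k P" "j \<ominus>\<^bsub>A\<^esub> \<phi> g \<in> A.aug_power 2" by blast
    have fg: "f \<in> carrier P" "g \<in> carrier P" using P_carr f g by blast+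
    have ij: "i \<in> carrier A" "j \<in> carrier A" using A_carr prod by blast+
    have "(i \<ominus>\<^bsub>A\<^esub> \<phi> f) \<otimes>\<^bsub>A\<^esub> j \<in> A.aug_power (Suc (Suc n))"
      unfolding ideal_power.simps(2)[of A _ "Suc n"] by (rule ideal_prod.prod[OF f(2) prod(2)])
    moreover have "\<phi> f \<otimes>\<^bsub>A\<^esub> (j \<ominus>\<^bsub>A\<^esub> \<phi> g) \<in> A.aug_power (Suc (Suc n))"
      using A.A.ideal_power_mult[OF A.ideal_aug_ideal hom_aug_power[OF f(1)] g(2)] by simp
    \<comment> \<open>Both error terms reach exponent n + 2: the first pairs an error in
      \<open>I^(n+1)\<close> with \<open>j\<close> in \<open>I\<close>, the second an element of
      \<open>I^n\<close> with an error in \<open>I^2\<close>.\<close>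
    moreover have "i \<otimes>\<^bsub>A\<^esub> j \<ominus>\<^bsub>A\<^esub> \<phi> f \<otimes>\<^bsub>A\<^esub> \<phi> g
        = (i \<ominus>\<^bsub>A\<^esub> \<phi> f) \<otimes>\<^bsub>A\<^esub> j \<oplus>\<^bsub>A\<^esub> \<phi> f \<otimes>\<^bsub>A\<^esub> (j \<ominus>\<^bsub>A\<^esub> \<phi> g)"
      using ij hom.hom_closed[OF fg(1)] hom.hom_closed[OF fg(2)] by algebra
    ultimately have "i \<otimes>\<^bsub>A\<^esub> j \<ominus>\<^bsub>A\<^esub> \<phi> (f \<otimes>\<^bsub>P\<^esub> g) \<in> A.aug_power (Suc (Suc n))"
      using fg by (simp add: J.a_closed)
    moreover have "f \<otimes>\<^bsub>P\<^esub> g \<in> P.aug_power (Suc n)"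
      using f g by (simp add: ideal_power.simps(2) ideal_prod.prod)
    ultimately show ?case by blast
  next
    case (sum s t)
    then obtain f g where fg: "f \<in> P.aug_power (Suc n)" "s \<ominus>\<^bsub>A\<^esub> \<phi> f \<in> A.aug_power (Suc (Suc n))"
      "g \<in> P.aug_power (Suc n)" "t \<ominus>\<^bsub>A\<^esub> \<phi> g \<in> A.aug_power (Suc (Suc n))" by blast
    have fgP: "f \<in> carrier P" "g \<in> carrier P" using P_carr fg by blast+
    have "s \<in> carrier A" "t \<in> carrier A"
      using A.A.ideal_prod_in_carrier[OF A.ideal_aug_power A.ideal_aug_ideal] sum by blast+
    then have "(s \<oplus>\<^bsub>A\<^esub> t) \<ominus>\<^bsub>A\<^esub> \<phi> (f \<oplus>\<^bsub>P\<^esub> g) \<in> A.aug_power (Suc (Suc n))"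
      using fg fgP by (simp add: J.diff_add)
    moreover have "f \<oplus>\<^bsub>P\<^esub> g \<in> P.aug_power (Suc n)"
      using fg additive_subgroup.a_closed[OF ideal.axioms(1)[OF P.ideal_aug_power]] by blast
    ultimately show ?case by blast
  qed
qed

lemma surj_of_generating:
  assumes gen: "\<And>j. j \<in> aug_ideal k A \<Longrightarrow> \<exists>g\<in>aug_ideal k P. j \<ominus>\<^bsub>A\<^esub> \<phi> g \<in> A.aug_power 2"
    and "A.adic_separated" "P.adic_cauchy_complete"
  shows "\<phi> ` carrier P = carrier A"
proof
  show "\<phi> ` carrier P \<subseteq> carrier A" by (rule image_subsetI) simp
  show "carrier A \<subseteq> \<phi> ` carrier P"
  proof
    fix a assume a: "a \<in> carrier A"
    \<comment> \<open>The correction at stage \<open>n\<close> is taken from I(P)^n, so the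
      approximations are Cauchy in \<open>P\<close> while their images approach \<open>a\<close>.
      Any start will do because \<open>I^0\<close> is all of \<open>A\<close>.\<close>
    have "\<exists>F. \<forall>n. (F n \<in> carrier P \<and> a \<ominus>\<^bsub>A\<^esub> \<phi> (F n) \<in> A.aug_power n)
        \<and> F (Suc n) \<ominus>\<^bsub>P\<^esub> F n \<in> P.aug_power n"
    proof (rule dependent_nat_choice)
      show "\<exists>f. f \<in> carrier P \<and> a \<ominus>\<^bsub>A\<^esub> \<phi> f \<in> A.aug_power 0"
        by (rule exI[of _ "\<zero>\<^bsub>P\<^esub>"]) (simp add: a)
      fix f n assume f: "f \<in> carrier P \<and> a \<ominus>\<^bsub>A\<^esub> \<phi> f \<in> A.aug_power n"
      then obtain p where p: "p \<in> P.aug_power n"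
        "(a \<ominus>\<^bsub>A\<^esub> \<phi> f) \<ominus>\<^bsub>A\<^esub> \<phi> p \<in> A.aug_power (Suc n)"
        using lift_aug_power[OF gen] by blast
      have pc: "p \<in> carrier P" using p(1) ideal.Icarr[OF P.ideal_aug_power] by blast
      have "(f \<oplus>\<^bsub>P\<^esub> p) \<ominus>\<^bsub>P\<^esub> f = p" using f pc by algebra
      moreover have "a \<ominus>\<^bsub>A\<^esub> (\<phi> f \<oplus>\<^bsub>A\<^esub> \<phi> p) = (a \<ominus>\<^bsub>A\<^esub> \<phi> f) \<ominus>\<^bsub>A\<^esub> \<phi> p"
        using a hom.hom_closed[OF conjunct1[OF f]] hom.hom_closed[OF pc] by algebra
      ultimately show "\<exists>g. (g \<in> carrier P \<and> a \<ominus>\<^bsub>A\<^esub> \<phi> g \<in> A.aug_power (Suc n))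
          \<and> g \<ominus>\<^bsub>P\<^esub> f \<in> P.aug_power n"
        using f p pc by (intro exI[of _ "f \<oplus>\<^bsub>P\<^esub> p"]) simp
    qed
    then obtain F where F: "\<And>n. F n \<in> carrier P" "\<And>n. a \<ominus>\<^bsub>A\<^esub> \<phi> (F n) \<in> A.aug_power n"
      "\<And>n. F (Suc n) \<ominus>\<^bsub>P\<^esub> F n \<in> P.aug_power n" by blast
    obtain f where f: "f \<in> carrier P" "\<And>n. f \<ominus>\<^bsub>P\<^esub> F n \<in> P.aug_power n"
      using P.adic_cauchy_completeE[OF assms(3) F(1,3)] by blast
    have "\<phi> f \<ominus>\<^bsub>A\<^esub> a \<in> A.aug_power n" for n
    proof -
      interpret J: ideal "A.aug_power n" A by (rule A.ideal_aug_power)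
      have "\<phi> f \<ominus>\<^bsub>A\<^esub> \<phi> (F n) \<in> A.aug_power n"
        using hom_aug_power[OF f(2)[of n]] f F by (simp add: hom_diff)
      then show ?thesis
        using J.diff_trans[of "\<phi> f" "\<phi> (F n)" a] J.diff_sym[of a "\<phi> (F n)"] a f(1) F(1,2)
        by simp
    qed
    then have "\<phi> f = a" using assms(2) f a by (intro A.adic_separatedD) simp_all
    with f show "a \<in> \<phi> ` carrier P" by blast
  qed
qed

end

section \<open>Truncated evaluation at a family in the augmentation ideal\<close>

locale series_evaluation = S: nc_series k X + A: augmented_algebra k A
  for k :: "('k, 'm) ring_scheme" and X :: "'x set" and A :: "('k, 'a, 'n) aug_algebra_scheme" +
  fixes y :: "'x \<Rightarrow> 'a"
  assumes finite_vars: "finite X" and y_aug: "x \<in> X \<Longrightarrow> y x \<in> aug_ideal k A"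
begin

lemma y_closed [simp]: "x \<in> X \<Longrightarrow> y x \<in> carrier A"
  using y_aug by (simp add: A.mem_aug_ideal)

text \<open>The sum, over all words \<open>w\<close> of length less than \<open>n\<close>, of
  \<open>f w\<close> times the product of the \<open>y x\<close> along \<open>w\<close>, arranged by
  last letters as in Horner's scheme. The recursion avoids sums over words and matches the rules for
  \<open>shift\<close>.\<close>

primrec eval_below :: "nat \<Rightarrow> ('x list \<Rightarrow> 'k) \<Rightarrow> 'a"
  where
    "eval_below 0 f = \<zero>\<^bsub>A\<^esub>"
  | "eval_below (Suc n) f = f [] \<odot>\<^bsub>A\<^esub> \<one>\<^bsub>A\<^esub> \<oplus>\<^bsub>A\<^esub>
      (\<Oplus>\<^bsub>A\<^esub>x\<in>X. eval_below n (S.shift x f) \<otimes>\<^bsub>A\<^esub> y x)"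

lemma coeff_Nil_closed [simp]: "f \<in> carrier S.P \<Longrightarrow> f [] \<in> carrier k"
  by (rule S.coeff_closed) simp_all

lemma eval_below_closed [simp]: "f \<in> carrier S.P \<Longrightarrow> eval_below n f \<in> carrier A"
  by (induction n arbitrary: f) simp_all

lemma shift_add:
  "x \<in> X \<Longrightarrow> f \<in> carrier S.P \<Longrightarrow> g \<in> carrier S.P \<Longrightarrow>
    S.shift x (f \<oplus>\<^bsub>S.P\<^esub> g) = S.shift x f \<oplus>\<^bsub>S.P\<^esub> S.shift x g"
  by (rule S.series_eqI) (simp_all add: S.series_closed)

lemma shift_smult:
  "x \<in> X \<Longrightarrow> f \<in> carrier S.P \<Longrightarrow> c \<in> carrier k \<Longrightarrow>
    S.shift x (c \<odot>\<^bsub>S.P\<^esub> f) = c \<odot>\<^bsub>S.P\<^esub> S.shift x f"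
  by (rule S.series_eqI) (simp_all add: S.series_closed)

lemma eval_below_add:
  assumes "f \<in> carrier S.P" "g \<in> carrier S.P"
  shows "eval_below n (f \<oplus>\<^bsub>S.P\<^esub> g) = eval_below n f \<oplus>\<^bsub>A\<^esub> eval_below n g"
  using assms
proof (induction n arbitrary: f g)
  case (Suc n)
  have "(\<Oplus>\<^bsub>A\<^esub>x\<in>X. eval_below n (S.shift x (f \<oplus>\<^bsub>S.P\<^esub> g)) \<otimes>\<^bsub>A\<^esub> y x)
      = (\<Oplus>\<^bsub>A\<^esub>x\<in>X. eval_below n (S.shift x f) \<otimes>\<^bsub>A\<^esub> y x \<oplus>\<^bsub>A\<^esub> eval_below n (S.shift x g) \<otimes>\<^bsub>A\<^esub> y x)"
    using Suc by (intro A.M.finsum_cong' funcsetI refl) (simp_all add: shift_add A.A.l_distr)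
  also have "\<dots> = (\<Oplus>\<^bsub>A\<^esub>x\<in>X. eval_below n (S.shift x f) \<otimes>\<^bsub>A\<^esub> y x)
      \<oplus>\<^bsub>A\<^esub> (\<Oplus>\<^bsub>A\<^esub>x\<in>X. eval_below n (S.shift x g) \<otimes>\<^bsub>A\<^esub> y x)"
    using Suc.prems by (intro A.M.finsum_addf funcsetI) simp_all
  finally show ?case
    using Suc.prems by (simp add: A.smult_l_distr A.M.a_ac)
qed simp

lemma eval_below_smult:
  assumes "c \<in> carrier k" "f \<in> carrier S.P"
  shows "eval_below n (c \<odot>\<^bsub>S.P\<^esub> f) = c \<odot>\<^bsub>A\<^esub> eval_below n f"
  using assms
proof (induction n arbitrary: f)
  case (Suc n)
  have "(\<Oplus>\<^bsub>A\<^esub>x\<in>X. eval_below n (S.shift x (c \<odot>\<^bsub>S.P\<^esub> f)) \<otimes>\<^bsub>A\<^esub> y x)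
      = (\<Oplus>\<^bsub>A\<^esub>x\<in>X. c \<odot>\<^bsub>A\<^esub> (eval_below n (S.shift x f) \<otimes>\<^bsub>A\<^esub> y x))"
    using Suc by (intro A.M.finsum_cong' funcsetI refl) (simp_all add: shift_smult A.smult_mult_left)
  also have "\<dots> = c \<odot>\<^bsub>A\<^esub> (\<Oplus>\<^bsub>A\<^esub>x\<in>X. eval_below n (S.shift x f) \<otimes>\<^bsub>A\<^esub> y x)"
    using Suc.prems by (intro A.finsum_smult_ldistr[symmetric] finite_vars funcsetI) simp_all
  finally show ?case
    using Suc.prems by (simp add: A.smult_r_distr A.smult_assoc1)
qed simp

lemma eval_below_zero: "eval_below n \<zero>\<^bsub>S.P\<^esub> = \<zero>\<^bsub>A\<^esub>"
proof -
  have "\<zero>\<^bsub>S.P\<^esub> = \<zero>\<^bsub>k\<^esub> \<odot>\<^bsub>S.P\<^esub> \<zero>\<^bsub>S.P\<^esub>" by simp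
  then have "eval_below n \<zero>\<^bsub>S.P\<^esub> = \<zero>\<^bsub>k\<^esub> \<odot>\<^bsub>A\<^esub> eval_below n \<zero>\<^bsub>S.P\<^esub>"
    using eval_below_smult[of "\<zero>\<^bsub>k\<^esub>" "\<zero>\<^bsub>S.P\<^esub>" n] by simp
  then show ?thesis by simp
qed

text \<open>The bound has to be positive: \<open>eval_below 0\<close> omits even the constant
  coefficient.\<close>

lemma eval_below_one: "eval_below (Suc n) \<one>\<^bsub>S.P\<^esub> = \<one>\<^bsub>A\<^esub>"
proof -
  have "S.shift x \<one>\<^bsub>S.P\<^esub> = \<zero>\<^bsub>S.P\<^esub>" if "x \<in> X" for x
    using that by (intro S.series_eqI) (simp_all add: S.series_closed)
  then have "(\<Oplus>\<^bsub>A\<^esub>x\<in>X. eval_below n (S.shift x \<one>\<^bsub>S.P\<^esub>) \<otimes>\<^bsub>A\<^esub> y x) = (\<Oplus>\<^bsub>A\<^esub>x\<in>X. \<zero>\<^bsub>A\<^esub>)"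
    by (intro A.M.finsum_cong' funcsetI refl) (simp_all add: eval_below_zero)
  then show ?thesis by simp
qed

lemma eval_below_1: "f \<in> carrier S.P \<Longrightarrow> eval_below (Suc 0) f = f [] \<odot>\<^bsub>A\<^esub> \<one>\<^bsub>A\<^esub>"
proof -
  assume "f \<in> carrier S.P"
  moreover have "(\<Oplus>\<^bsub>A\<^esub>x\<in>X. \<zero>\<^bsub>A\<^esub> \<otimes>\<^bsub>A\<^esub> y x) = (\<Oplus>\<^bsub>A\<^esub>x\<in>X. \<zero>\<^bsub>A\<^esub>)"
    by (intro A.M.finsum_cong' funcsetI refl) simp_all
  ultimately show ?thesis by simp
qed

declare eval_below.simps(2) [simp del]

text \<open>Each letter is worth one power of \<open>I\<close>; this is the gain from
  \<open>n\<close> to \<open>Suc n\<close> in the inductions on truncations.\<close>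

lemma mult_y_mem:
  assumes "a \<in> carrier A" "b \<in> carrier A" "a \<ominus>\<^bsub>A\<^esub> b \<in> A.aug_power n" "x \<in> X"
  shows "a \<otimes>\<^bsub>A\<^esub> y x \<ominus>\<^bsub>A\<^esub> b \<otimes>\<^bsub>A\<^esub> y x \<in> A.aug_power (Suc n)"
proof -
  have "a \<otimes>\<^bsub>A\<^esub> y x \<ominus>\<^bsub>A\<^esub> b \<otimes>\<^bsub>A\<^esub> y x = (a \<ominus>\<^bsub>A\<^esub> b) \<otimes>\<^bsub>A\<^esub> y x"
    using assms(1,2) y_closed[OF assms(4)] by algebra
  also have "\<dots> \<in> A.aug_power (Suc n)"
    unfolding ideal_power.simps(2) by (rule ideal_prod.prod[OF assms(3) y_aug[OF assms(4)]])
  finally show ?thesis .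
qed

text \<open>The two truncations differ by the words of length \<open>n\<close>, each of which
  evaluates to a multiple of a product of \<open>n\<close> elements of \<open>I\<close>.\<close>

lemma eval_below_step:
  assumes "f \<in> carrier S.P"
  shows "eval_below (Suc n) f \<ominus>\<^bsub>A\<^esub> eval_below n f \<in> A.aug_power n"
  using assms
proof (induction n arbitrary: f)
  case 0
  then show ?case using eval_below_closed[of f "Suc 0"] by simp
next
  case (Suc n)
  interpret J: ideal "A.aug_power (Suc n)" A by (rule A.ideal_aug_power)
  have "(\<Oplus>\<^bsub>A\<^esub>x\<in>X. eval_below (Suc n) (S.shift x f) \<otimes>\<^bsub>A\<^esub> y x)
      \<ominus>\<^bsub>A\<^esub> (\<Oplus>\<^bsub>A\<^esub>x\<in>X. eval_below n (S.shift x f) \<otimes>\<^bsub>A\<^esub> y x) \<in> A.aug_power (Suc n)"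
    using Suc by (intro J.diff_finsum finite_vars mult_y_mem funcsetI eval_below_closed A.A.m_closed) simp_all
  moreover have "f [] \<odot>\<^bsub>A\<^esub> \<one>\<^bsub>A\<^esub> \<in> carrier A" using Suc.prems by simp
  moreover have "(\<Oplus>\<^bsub>A\<^esub>x\<in>X. eval_below m (S.shift x f) \<otimes>\<^bsub>A\<^esub> y x) \<in> carrier A" for m
    using Suc.prems by (intro A.M.finsum_closed funcsetI) simp
  ultimately show ?case
    unfolding eval_below.simps(2)[of "Suc n" f] eval_below.simps(2)[of n f]
    by (intro J.diff_add J.diff_self) 
qed

text \<open>The product of the truncations has additional words, of length \<open>n\<close> and
  more, hence only a congruence. The induction keeps \<open>f\<close> fixed and strips letters from
  \<open>g\<close>.\<close>

lemma eval_below_mult: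
  assumes "f \<in> carrier S.P" "g \<in> carrier S.P"
  shows "eval_below n (f \<otimes>\<^bsub>S.P\<^esub> g) \<ominus>\<^bsub>A\<^esub> eval_below n f \<otimes>\<^bsub>A\<^esub> eval_below n g \<in> A.aug_power n"
  using assms(2)
proof (induction n arbitrary: g)
  case 0
  then show ?case using assms by simp
next
  case (Suc n)
  note f = assms(1) and g = Suc.prems
  interpret J: ideal "A.aug_power (Suc n)" A by (rule A.ideal_aug_power)
  interpret J': ideal "A.aug_power n" A by (rule A.ideal_aug_power)
  \<comment> \<open>Both sides will become \<open>g []\<close> times this same \<open>E\<close> plus
    a sum over last letters, so that only the two sums remain to be compared.\<close>
  define E where "E = eval_below (Suc n) f"
  have E: "E \<in> carrier A" unfolding E_def using f by (rule eval_below_closed)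
  have U: "(\<Oplus>\<^bsub>A\<^esub>x\<in>X. eval_below n (f \<otimes>\<^bsub>S.P\<^esub> S.shift x g) \<otimes>\<^bsub>A\<^esub> y x) \<in> carrier A" (is "?U \<in> _")
    using f g by (intro A.M.finsum_closed funcsetI) simp
  have F: "(\<Oplus>\<^bsub>A\<^esub>x\<in>X. eval_below n (S.shift x f) \<otimes>\<^bsub>A\<^esub> y x) \<in> carrier A" (is "?F \<in> _")
    using f by (intro A.M.finsum_closed funcsetI) simp
  have G: "(\<Oplus>\<^bsub>A\<^esub>x\<in>X. eval_below n (S.shift x g) \<otimes>\<^bsub>A\<^esub> y x) \<in> carrier A" (is "?G \<in> _")
    using g by (intro A.M.finsum_closed funcsetI) simp
  have "(\<Oplus>\<^bsub>A\<^esub>x\<in>X. eval_below n (S.shift x (f \<otimes>\<^bsub>S.P\<^esub> g)) \<otimes>\<^bsub>A\<^esub> y x)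
      = (\<Oplus>\<^bsub>A\<^esub>x\<in>X. eval_below n (f \<otimes>\<^bsub>S.P\<^esub> S.shift x g) \<otimes>\<^bsub>A\<^esub> y x
          \<oplus>\<^bsub>A\<^esub> g [] \<odot>\<^bsub>A\<^esub> (eval_below n (S.shift x f) \<otimes>\<^bsub>A\<^esub> y x))"
    using f g
    by (intro A.M.finsum_cong' funcsetI refl)
      (simp_all add: S.shift_mult eval_below_add eval_below_smult A.A.l_distr A.smult_mult_left)
  also have "\<dots> = ?U \<oplus>\<^bsub>A\<^esub> (\<Oplus>\<^bsub>A\<^esub>x\<in>X. g [] \<odot>\<^bsub>A\<^esub> (eval_below n (S.shift x f) \<otimes>\<^bsub>A\<^esub> y x))"
    using f g by (intro A.M.finsum_addf funcsetI) simp_all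
  also have "(\<Oplus>\<^bsub>A\<^esub>x\<in>X. g [] \<odot>\<^bsub>A\<^esub> (eval_below n (S.shift x f) \<otimes>\<^bsub>A\<^esub> y x)) = g [] \<odot>\<^bsub>A\<^esub> ?F"
    using f g by (intro A.finsum_smult_ldistr[symmetric] finite_vars funcsetI) simp_all
  finally have "eval_below (Suc n) (f \<otimes>\<^bsub>S.P\<^esub> g)
      = (f [] \<otimes>\<^bsub>k\<^esub> g []) \<odot>\<^bsub>A\<^esub> \<one>\<^bsub>A\<^esub> \<oplus>\<^bsub>A\<^esub> (?U \<oplus>\<^bsub>A\<^esub> g [] \<odot>\<^bsub>A\<^esub> ?F)"
    using f g by (simp add: eval_below.simps(2))
  also have "\<dots> = g [] \<odot>\<^bsub>A\<^esub> E \<oplus>\<^bsub>A\<^esub> ?U"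
    using f g U F
    by (simp add: E_def eval_below.simps(2) A.smult_r_distr A.smult_assoc1[symmetric] S.m_comm A.M.a_ac)
  finally have fg: "eval_below (Suc n) (f \<otimes>\<^bsub>S.P\<^esub> g) = g [] \<odot>\<^bsub>A\<^esub> E \<oplus>\<^bsub>A\<^esub> ?U" .
  have "E \<otimes>\<^bsub>A\<^esub> ?G = (\<Oplus>\<^bsub>A\<^esub>x\<in>X. E \<otimes>\<^bsub>A\<^esub> (eval_below n (S.shift x g) \<otimes>\<^bsub>A\<^esub> y x))"
    using E g by (intro A.A.finsum_rdistr finite_vars funcsetI) simp_all
  also have "\<dots> = (\<Oplus>\<^bsub>A\<^esub>x\<in>X. (E \<otimes>\<^bsub>A\<^esub> eval_below n (S.shift x g)) \<otimes>\<^bsub>A\<^esub> y x)"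
    using E g by (intro A.M.finsum_cong' funcsetI refl) (simp_all add: A.A.m_assoc)
  finally have EG: "E \<otimes>\<^bsub>A\<^esub> ?G = \<dots>" .
  have "E \<otimes>\<^bsub>A\<^esub> eval_below (Suc n) g = E \<otimes>\<^bsub>A\<^esub> (g [] \<odot>\<^bsub>A\<^esub> \<one>\<^bsub>A\<^esub>) \<oplus>\<^bsub>A\<^esub> E \<otimes>\<^bsub>A\<^esub> ?G"
    using E G g by (simp add: eval_below.simps(2) A.A.r_distr)
  also have "E \<otimes>\<^bsub>A\<^esub> (g [] \<odot>\<^bsub>A\<^esub> \<one>\<^bsub>A\<^esub>) = g [] \<odot>\<^bsub>A\<^esub> E"
    using E g by (simp add: A.smult_mult_right)
  finally have E_g: "E \<otimes>\<^bsub>A\<^esub> eval_below (Suc n) g = g [] \<odot>\<^bsub>A\<^esub> E \<oplus>\<^bsub>A\<^esub> E \<otimes>\<^bsub>A\<^esub> ?G" .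
  have "eval_below n (f \<otimes>\<^bsub>S.P\<^esub> S.shift x g) \<ominus>\<^bsub>A\<^esub> E \<otimes>\<^bsub>A\<^esub> eval_below n (S.shift x g) \<in> A.aug_power n"
    if x: "x \<in> X" for x
  proof -
    have sg: "S.shift x g \<in> carrier S.P" using x g by simp
    \<comment> \<open>The induction hypothesis concerns the truncation of \<open>f\<close> at
      \<open>n\<close>, while \<open>E\<close> is truncated one length later. They agree modulo
      \<open>I^n\<close>, which suffices because the factor \<open>y x\<close> supplies the missing
      power.\<close>
    have "eval_below n f \<ominus>\<^bsub>A\<^esub> E \<in> A.aug_power n"
      unfolding E_def
      by (rule J'.diff_sym[OF eval_below_closed[OF f] eval_below_closed[OF f] eval_below_step[OF f]])
    then have "eval_below n f \<otimes>\<^bsub>A\<^esub> eval_below n (S.shift x g)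
        \<ominus>\<^bsub>A\<^esub> E \<otimes>\<^bsub>A\<^esub> eval_below n (S.shift x g) \<in> A.aug_power n"
      using f sg E by (intro J'.diff_mult J'.diff_self eval_below_closed)
    then show ?thesis
      by (rule J'.diff_trans[rotated 4, OF _ _ _ _ Suc.IH[OF sg]]) (use f sg E in simp_all)
  qed
  then have "?U \<ominus>\<^bsub>A\<^esub> E \<otimes>\<^bsub>A\<^esub> ?G \<in> A.aug_power (Suc n)"
    unfolding EG using f g E
    by (intro J.diff_finsum finite_vars mult_y_mem funcsetI) simp_all
  then show ?case
    unfolding fg E_def[symmetric] E_g using E G U g
    by (intro J.diff_add J.diff_self) simp_all
qed

lemma evaluation_aug_hom:
  assumes sep: "A.adic_separated" and complete: "A.adic_cauchy_complete"
  obtains \<phi> where "aug_algebra_hom k S.P A \<phi>"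
    "\<And>f n. f \<in> carrier S.P \<Longrightarrow> \<phi> f \<ominus>\<^bsub>A\<^esub> eval_below n f \<in> A.aug_power n"
proof -
  have "\<forall>f\<in>carrier S.P. \<exists>a. a \<in> carrier A \<and> (\<forall>n. a \<ominus>\<^bsub>A\<^esub> eval_below n f \<in> A.aug_power n)"
  proof
    fix f assume f: "f \<in> carrier S.P"
    show "\<exists>a. a \<in> carrier A \<and> (\<forall>n. a \<ominus>\<^bsub>A\<^esub> eval_below n f \<in> A.aug_power n)"
      by (rule A.adic_cauchy_completeE[OF complete eval_below_closed[OF f] eval_below_step[OF f]]) blast
  qed
  then obtain \<phi> where \<phi>: "\<And>f. f \<in> carrier S.P \<Longrightarrow> \<phi> f \<in> carrier A"
    "\<And>f n. f \<in> carrier S.P \<Longrightarrow> \<phi> f \<ominus>\<^bsub>A\<^esub> eval_below n f \<in> A.aug_power n"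
    unfolding bchoice_iff by blast
  \<comment> \<open>Separatedness makes the limit unique, so each law for \<phi> reduces to a
    congruence with the truncations at every level.\<close>
  have eqI: "\<phi> f = a" if "f \<in> carrier S.P" "a \<in> carrier A" "\<And>n. a \<ominus>\<^bsub>A\<^esub> eval_below n f \<in> A.aug_power n" for f a
  proof (rule A.adic_separatedD[OF sep \<phi>(1)[OF that(1)] that(2)])
    fix n
    interpret J: ideal "A.aug_power n" A by (rule A.ideal_aug_power)
    have "eval_below n f \<ominus>\<^bsub>A\<^esub> a \<in> A.aug_power n"
      by (rule J.diff_sym[OF that(2) eval_below_closed[OF that(1)] that(3)])
    then show "\<phi> f \<ominus>\<^bsub>A\<^esub> a \<in> A.aug_power n"
      by (rule J.diff_trans[rotated 4, OF _ \<phi>(1) _ _ \<phi>(2)]) (use that in simp_all)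
  qed
  have "\<phi> \<in> ring_hom S.P A"
  proof (rule ring_hom_memI)
    fix f g assume fg: "f \<in> carrier S.P" "g \<in> carrier S.P"
    show "\<phi> (f \<otimes>\<^bsub>S.P\<^esub> g) = \<phi> f \<otimes>\<^bsub>A\<^esub> \<phi> g"
    proof (rule eqI)
      fix n
      interpret J: ideal "A.aug_power n" A by (rule A.ideal_aug_power)
      have "\<phi> f \<otimes>\<^bsub>A\<^esub> \<phi> g \<ominus>\<^bsub>A\<^esub> eval_below n f \<otimes>\<^bsub>A\<^esub> eval_below n g \<in> A.aug_power n"
        using fg by (intro J.diff_mult \<phi>) simp_all
      moreover have "eval_below n f \<otimes>\<^bsub>A\<^esub> eval_below n g \<ominus>\<^bsub>A\<^esub> eval_below n (f \<otimes>\<^bsub>S.P\<^esub> g) \<in> A.aug_power n"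
        by (rule J.diff_sym[OF _ _ eval_below_mult]) (use fg in simp_all)
      ultimately show "\<phi> f \<otimes>\<^bsub>A\<^esub> \<phi> g \<ominus>\<^bsub>A\<^esub> eval_below n (f \<otimes>\<^bsub>S.P\<^esub> g) \<in> A.aug_power n"
        by (rule J.diff_trans[rotated 3]) (use fg \<phi> in simp_all)
    qed (use fg \<phi> in simp_all)
    show "\<phi> (f \<oplus>\<^bsub>S.P\<^esub> g) = \<phi> f \<oplus>\<^bsub>A\<^esub> \<phi> g"
    proof (rule eqI)
      fix n
      interpret J: ideal "A.aug_power n" A by (rule A.ideal_aug_power)
      show "\<phi> f \<oplus>\<^bsub>A\<^esub> \<phi> g \<ominus>\<^bsub>A\<^esub> eval_below n (f \<oplus>\<^bsub>S.P\<^esub> g) \<in> A.aug_power n"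
        unfolding eval_below_add[OF fg] using fg by (intro J.diff_add \<phi>) simp_all
    qed (use fg \<phi> in simp_all)
  next
    show "\<phi> \<one>\<^bsub>S.P\<^esub> = \<one>\<^bsub>A\<^esub>"
    proof (rule eqI)
      fix n
      interpret J: ideal "A.aug_power n" A by (rule A.ideal_aug_power)
      \<comment> \<open>At level 0 the truncation is zero instead of the unit, but
        \<open>I^0\<close> is all of \<open>A\<close>.\<close>
      show "\<one>\<^bsub>A\<^esub> \<ominus>\<^bsub>A\<^esub> eval_below n \<one>\<^bsub>S.P\<^esub> \<in> A.aug_power n"
        by (cases n) (use J.diff_self in \<open>simp_all add: eval_below_one\<close>)
    qed simp_all
  qed (rule \<phi>)
  moreover have "\<phi> (c \<odot>\<^bsub>S.P\<^esub> f) = c \<odot>\<^bsub>A\<^esub> \<phi> f" if "c \<in> carrier k" "f \<in> carrier S.P" for c f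
  proof (rule eqI)
    show "c \<odot>\<^bsub>A\<^esub> \<phi> f \<ominus>\<^bsub>A\<^esub> eval_below n (c \<odot>\<^bsub>S.P\<^esub> f) \<in> A.aug_power n" for n
      using A.ideal_smult_closed[OF A.ideal_aug_power that(1) \<phi>(2)[OF that(2)], of n] that \<phi>
      by (simp add: A.smult_r_diff eval_below_smult)
  qed (use that \<phi> in simp_all)
  moreover have "aug A (\<phi> f) = aug S.P f" if "f \<in> carrier S.P" for f
  proof -
    \<comment> \<open>Level 1 decides the augmentation: the truncation there is just the constant
      coefficient, and the error lies in \<open>I\<close>.\<close>
    have "\<phi> f \<ominus>\<^bsub>A\<^esub> f [] \<odot>\<^bsub>A\<^esub> \<one>\<^bsub>A\<^esub> \<in> aug_ideal k A"
      using \<phi>(2)[OF that, of "Suc 0"] unfolding eval_below_1[OF that] A.aug_power_1 .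
    then show ?thesis
      using that \<phi>(1)[OF that] by (simp add: A.mem_aug_ideal A.aug_diff A.aug_smult S.aug_series S.diff_eq_zero_iff)
  qed
  ultimately have "\<phi> \<in> aug_hom k S.P A" by (simp add: aug_hom_def)
  then have "aug_algebra_hom k S.P A \<phi>" by unfold_locales
  then show thesis using \<phi>(2) by (rule that)
qed

text \<open>The homogeneous series of degree one with coefficient \<open>c x\<close> at the letter
  \<open>x\<close>. Giving the coefficients directly lets \<open>shift\<close> read off
  \<open>c x\<close>; \<open>hd\<close> is met only on words of length 1.\<close>

definition linear_form :: "('x \<Rightarrow> 'k) \<Rightarrow> 'x list \<Rightarrow> 'k"
  where "linear_form c = (\<lambda>w\<in>lists X. if length w = 1 then c (hd w) else \<zero>\<^bsub>k\<^esub>)"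

lemma linear_form_mem:
  assumes "c \<in> X \<rightarrow> carrier k"
  shows "linear_form c \<in> aug_ideal k S.P"
proof -
  have "c (hd w) \<in> carrier k" if "w \<in> lists X" "length w = 1" for w
    using that assms by (cases w) auto
  then have "linear_form c \<in> carrier S.P"
    unfolding linear_form_def by (intro S.seriesI) simp
  then show ?thesis by (simp add: S.mem_aug_ideal_series linear_form_def)
qed

text \<open>The bound 2 is the first to see words of length 1, and it is also the level at which
  truncations are correct modulo \<open>I^2\<close>, where the generators live.\<close>

lemma eval_below_linear_form:
  assumes c: "c \<in> X \<rightarrow> carrier k"
  shows "eval_below 2 (linear_form c) = (\<Oplus>\<^bsub>A\<^esub>x\<in>X. c x \<odot>\<^bsub>A\<^esub> y x)"
proof -
  have f: "linear_form c \<in> carrier S.P" "linear_form c [] = \<zero>\<^bsub>k\<^esub>"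
    using linear_form_mem[OF c] by (simp_all add: S.mem_aug_ideal_series)
  have "(\<Oplus>\<^bsub>A\<^esub>x\<in>X. eval_below (Suc 0) (S.shift x (linear_form c)) \<otimes>\<^bsub>A\<^esub> y x)
      = (\<Oplus>\<^bsub>A\<^esub>x\<in>X. c x \<odot>\<^bsub>A\<^esub> y x)"
  proof (intro A.M.finsum_cong' funcsetI refl)
    fix x assume x: "x \<in> X"
    then have cx: "c x \<in> carrier k" using c by auto
    then show "c x \<odot>\<^bsub>A\<^esub> y x \<in> carrier A" using x by simp
    have "S.shift x (linear_form c) [] = c x" using x by (simp add: linear_form_def)
    then show "eval_below (Suc 0) (S.shift x (linear_form c)) \<otimes>\<^bsub>A\<^esub> y x = c x \<odot>\<^bsub>A\<^esub> y x"
      using x cx f(1) by (simp add: eval_below_1 A.smult_mult_left)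
  qed
  moreover have "(\<Oplus>\<^bsub>A\<^esub>x\<in>X. c x \<odot>\<^bsub>A\<^esub> y x) \<in> carrier A"
    using c by (intro A.M.finsum_closed funcsetI) auto
  ultimately show ?thesis
    using f(2) by (simp add: numeral_2_eq_2 eval_below.simps(2)[of "Suc 0"])
qed

end

section \<open>Algebras of finite type\<close>

context augmented_algebra
begin

text \<open>The module \<open>I / I^2\<close> is formed over the record \<open>A\<close> with its
  carrier replaced, so its finite sums belong to another structure; the work lies in pulling them
  back to sums of representatives in \<open>A\<close>.\<close>

lemma finite_type_generators:
  assumes "finite_type k A"
  obtains S r where "finite (S :: 'a set set)" "\<And>s. s \<in> S \<Longrightarrow> r s \<in> aug_ideal k A"
    "\<And>j. j \<in> aug_ideal k A \<Longrightarrow>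
      \<exists>c\<in>S \<rightarrow> carrier k. j \<ominus>\<^bsub>A\<^esub> (\<Oplus>\<^bsub>A\<^esub>s\<in>S. c s \<odot>\<^bsub>A\<^esub> r s) \<in> \<I> 2"
proof -
  let ?J = "\<I> 2"
  let ?M = "A\<lparr>carrier := aug_ideal k A\<rparr>"
  let ?Q = "quot_module ?M ?J"
  interpret I: ideal "aug_ideal k A" A by (rule ideal_aug_ideal)
  interpret J: ideal ?J A by (rule ideal_aug_power)
  \<comment> \<open>Cosets and sums of sets do not refer to the carrier, so those of the restricted
    record are those of \<open>A\<close>.\<close>
  have cosets: "a_r_coset ?M = a_r_coset A" "set_add ?M = set_add A"
    by (simp_all add: a_r_coset_def r_coset_def set_add_def set_mult_def fun_eq_iff)
  have Q_carrier: "carrier ?Q = (\<lambda>j. ?J +>\<^bsub>A\<^esub> j) ` aug_ideal k A"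
    by (auto simp: quot_simps A_RCOSETS_def' cosets)
  have Q_add: "C \<oplus>\<^bsub>?Q\<^esub> D = C <+>\<^bsub>A\<^esub> D" for C D by (simp add: quot_simps cosets)
  have Q_zero: "\<zero>\<^bsub>?Q\<^esub> = ?J +>\<^bsub>A\<^esub> \<zero>\<^bsub>A\<^esub>" using J.a_subset by (simp add: quot_simps)
  have Q_smult: "c \<odot>\<^bsub>?Q\<^esub> (?J +>\<^bsub>A\<^esub> j) = ?J +>\<^bsub>A\<^esub> (c \<odot>\<^bsub>A\<^esub> j)"
    if "c \<in> carrier k" "j \<in> carrier A" for c j
    using smult_rcos[OF J.is_ideal that] by (simp add: quot_simps(6) cosets)
  have Q_sum: "(?J +>\<^bsub>A\<^esub> i) \<oplus>\<^bsub>?Q\<^esub> (?J +>\<^bsub>A\<^esub> j) = ?J +>\<^bsub>A\<^esub> (i \<oplus>\<^bsub>A\<^esub> j)"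
    if "i \<in> carrier A" "j \<in> carrier A" for i j
    using that by (simp add: Q_add J.a_rcos_sum)
  \<comment> \<open>Finite sums in \<open>?Q\<close> can be unfolded as soon as its addition is a
    commutative monoid.\<close>
  have Q: "abelian_monoid ?Q"
  proof (rule abelian_monoidI)
    show "\<zero>\<^bsub>?Q\<^esub> \<in> carrier ?Q" unfolding Q_zero Q_carrier by simp
    fix C D assume "C \<in> carrier ?Q" "D \<in> carrier ?Q"
    then obtain i j where ij: "i \<in> aug_ideal k A" "C = ?J +>\<^bsub>A\<^esub> i" "j \<in> aug_ideal k A" "D = ?J +>\<^bsub>A\<^esub> j"
      unfolding Q_carrier by blast
    then show "C \<oplus>\<^bsub>?Q\<^esub> D \<in> carrier ?Q" by (simp add: Q_sum I.Icarr) (simp add: Q_carrier)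
    from ij show "C \<oplus>\<^bsub>?Q\<^esub> D = D \<oplus>\<^bsub>?Q\<^esub> C" by (simp add: Q_sum I.Icarr M.a_comm)
    from ij show "\<zero>\<^bsub>?Q\<^esub> \<oplus>\<^bsub>?Q\<^esub> C = C" by (simp add: Q_sum I.Icarr Q_zero)
    fix E assume "E \<in> carrier ?Q"
    then obtain l where "l \<in> aug_ideal k A" "E = ?J +>\<^bsub>A\<^esub> l" unfolding Q_carrier by blast
    with ij show "C \<oplus>\<^bsub>?Q\<^esub> D \<oplus>\<^bsub>?Q\<^esub> E = C \<oplus>\<^bsub>?Q\<^esub> (D \<oplus>\<^bsub>?Q\<^esub> E)"
      by (simp add: Q_sum I.Icarr M.a_assoc)
  qed
  from assms obtain S where S: "finite S" "S \<subseteq> carrier ?Q"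
    and gen: "carrier ?Q = {(\<Oplus>\<^bsub>?Q\<^esub>s\<in>S. c s \<odot>\<^bsub>?Q\<^esub> s) | c. c \<in> S \<rightarrow> carrier k}"
    unfolding finite_type_def fin_gen_module_def by blast
  have "\<forall>s\<in>S. \<exists>r. r \<in> aug_ideal k A \<and> s = ?J +>\<^bsub>A\<^esub> r" using S(2) unfolding Q_carrier by blast
  then obtain r where r: "\<And>s. s \<in> S \<Longrightarrow> r s \<in> aug_ideal k A" "\<And>s. s \<in> S \<Longrightarrow> s = ?J +>\<^bsub>A\<^esub> r s"
    unfolding bchoice_iff by blast
  \<comment> \<open>Stated for subsets of \<open>S\<close>, because the representatives
    \<open>r\<close> and the coefficients \<open>c\<close> are controlled on \<open>S\<close>
    only.\<close>
  have finsum_Q: "(\<Oplus>\<^bsub>?Q\<^esub>s\<in>T. c s \<odot>\<^bsub>?Q\<^esub> s) = ?J +>\<^bsub>A\<^esub> (\<Oplus>\<^bsub>A\<^esub>s\<in>T. c s \<odot>\<^bsub>A\<^esub> r s)"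
    if "finite T" "T \<subseteq> S" and c: "c \<in> S \<rightarrow> carrier k" for T c
    using that(1,2)
  proof (induction T rule: finite_induct)
    case empty
    show ?case unfolding abelian_monoid.finsum_empty[OF Q] by (simp add: Q_zero)
  next
    case (insert s T)
    have smult: "c t \<odot>\<^bsub>?Q\<^esub> t = ?J +>\<^bsub>A\<^esub> (c t \<odot>\<^bsub>A\<^esub> r t)" "c t \<odot>\<^bsub>A\<^esub> r t \<in> aug_ideal k A" if "t \<in> S" for t
    proof -
      have "c t \<in> carrier k" "r t \<in> aug_ideal k A" using c that r by auto
      then show "c t \<odot>\<^bsub>A\<^esub> r t \<in> aug_ideal k A" by (rule ideal_smult_closed[OF ideal_aug_ideal])
      have "c t \<odot>\<^bsub>?Q\<^esub> (?J +>\<^bsub>A\<^esub> r t) = ?J +>\<^bsub>A\<^esub> (c t \<odot>\<^bsub>A\<^esub> r t)"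
        by (rule Q_smult[OF \<open>c t \<in> carrier k\<close> I.Icarr[OF \<open>r t \<in> aug_ideal k A\<close>]])
      then show "c t \<odot>\<^bsub>?Q\<^esub> t = ?J +>\<^bsub>A\<^esub> (c t \<odot>\<^bsub>A\<^esub> r t)" using r(2)[OF that] by metis
    qed
    have T: "(\<lambda>t. c t \<odot>\<^bsub>A\<^esub> r t) \<in> T \<rightarrow> carrier A" "c s \<odot>\<^bsub>A\<^esub> r s \<in> carrier A"
      using insert.prems smult(2) by (auto intro: I.Icarr)
    have QT: "(\<lambda>t. c t \<odot>\<^bsub>?Q\<^esub> t) \<in> T \<rightarrow> carrier ?Q" "c s \<odot>\<^bsub>?Q\<^esub> s \<in> carrier ?Q"
      using insert.prems smult unfolding Q_carrier by (auto simp: Pi_iff)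
    have "(\<Oplus>\<^bsub>?Q\<^esub>t\<in>insert s T. c t \<odot>\<^bsub>?Q\<^esub> t)
        = c s \<odot>\<^bsub>?Q\<^esub> s \<oplus>\<^bsub>?Q\<^esub> (\<Oplus>\<^bsub>?Q\<^esub>t\<in>T. c t \<odot>\<^bsub>?Q\<^esub> t)"
      by (rule abelian_monoid.finsum_insert[OF Q insert.hyps QT])
    also have "\<dots> = (?J +>\<^bsub>A\<^esub> (c s \<odot>\<^bsub>A\<^esub> r s)) \<oplus>\<^bsub>?Q\<^esub> (?J +>\<^bsub>A\<^esub> (\<Oplus>\<^bsub>A\<^esub>t\<in>T. c t \<odot>\<^bsub>A\<^esub> r t))"
      using insert smult(1) by simp
    also have "\<dots> = ?J +>\<^bsub>A\<^esub> (c s \<odot>\<^bsub>A\<^esub> r s \<oplus>\<^bsub>A\<^esub> (\<Oplus>\<^bsub>A\<^esub>t\<in>T. c t \<odot>\<^bsub>A\<^esub> r t))"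
      by (rule Q_sum[OF T(2) M.finsum_closed[OF T(1)]])
    also have "c s \<odot>\<^bsub>A\<^esub> r s \<oplus>\<^bsub>A\<^esub> (\<Oplus>\<^bsub>A\<^esub>t\<in>T. c t \<odot>\<^bsub>A\<^esub> r t) = (\<Oplus>\<^bsub>A\<^esub>t\<in>insert s T. c t \<odot>\<^bsub>A\<^esub> r t)"
      by (rule M.finsum_insert[OF insert.hyps T, symmetric])
    finally show ?case .
  qed
  have "\<exists>c\<in>S \<rightarrow> carrier k. j \<ominus>\<^bsub>A\<^esub> (\<Oplus>\<^bsub>A\<^esub>s\<in>S. c s \<odot>\<^bsub>A\<^esub> r s) \<in> ?J" if j: "j \<in> aug_ideal k A" for j
  proof -
    have "?J +>\<^bsub>A\<^esub> j \<in> carrier ?Q" using j unfolding Q_carrier by blast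
    then obtain c where c: "c \<in> S \<rightarrow> carrier k" "?J +>\<^bsub>A\<^esub> j = (\<Oplus>\<^bsub>?Q\<^esub>s\<in>S. c s \<odot>\<^bsub>?Q\<^esub> s)"
      unfolding gen by blast
    have "(\<Oplus>\<^bsub>A\<^esub>s\<in>S. c s \<odot>\<^bsub>A\<^esub> r s) \<in> carrier A"
      using c(1) r(1) I.Icarr by (intro M.finsum_closed funcsetI smult_closed) auto
    moreover have "?J +>\<^bsub>A\<^esub> j = ?J +>\<^bsub>A\<^esub> (\<Oplus>\<^bsub>A\<^esub>s\<in>S. c s \<odot>\<^bsub>A\<^esub> r s)"
      by (rule trans[OF c(2) finsum_Q[OF S(1) subset_refl c(1)]])
    ultimately have "j \<ominus>\<^bsub>A\<^esub> (\<Oplus>\<^bsub>A\<^esub>s\<in>S. c s \<odot>\<^bsub>A\<^esub> r s) \<in> ?J"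
      by (simp only: J.rcos_eq_iff_diff[OF I.Icarr[OF j]])
    with c(1) show ?thesis by (intro bexI[of _ c])
  qed
  with S(1) r(1) show thesis by (rule that)
qed

text \<open>Alphabets are to be sets of natural numbers, whereas the generators of
  \<open>I / I^2\<close> are cosets; a finite set of these is enumerated by an initial
  segment.\<close>

lemma finite_type_generators_nat:
  assumes "finite_type k A"
  obtains X y where "finite (X :: nat set)" "\<And>x. x \<in> X \<Longrightarrow> y x \<in> aug_ideal k A"
    "\<And>j. j \<in> aug_ideal k A \<Longrightarrow>
      \<exists>c\<in>X \<rightarrow> carrier k. j \<ominus>\<^bsub>A\<^esub> (\<Oplus>\<^bsub>A\<^esub>x\<in>X. c x \<odot>\<^bsub>A\<^esub> y x) \<in> \<I> 2"
proof -
  obtain S r where S: "finite (S :: 'a set set)" "\<And>s. s \<in> S \<Longrightarrow> r s \<in> aug_ideal k A"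
    "\<And>j. j \<in> aug_ideal k A \<Longrightarrow>
      \<exists>c\<in>S \<rightarrow> carrier k. j \<ominus>\<^bsub>A\<^esub> (\<Oplus>\<^bsub>A\<^esub>s\<in>S. c s \<odot>\<^bsub>A\<^esub> r s) \<in> \<I> 2"
    by (rule finite_type_generators[OF assms]) (rule that)
  from ex_bij_betw_nat_finite[OF S(1)] obtain e where e: "bij_betw e {0..<card S} S" by blast
  then have eS: "e ` {0..<card S} = S" "inj_on e {0..<card S}" by (simp_all add: bij_betw_def)
  have mem: "e x \<in> S" if "x \<in> {0..<card S}" for x using that eS(1) by blast
  show thesis
  proof (rule that[of "{0..<card S}" "r \<circ> e"])
    show "(r \<circ> e) x \<in> aug_ideal k A" if "x \<in> {0..<card S}" for x
      using S(2)[OF mem[OF that]] by simp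
    fix j assume "j \<in> aug_ideal k A"
    from S(3)[OF this] obtain c where c: "c \<in> S \<rightarrow> carrier k"
      "j \<ominus>\<^bsub>A\<^esub> (\<Oplus>\<^bsub>A\<^esub>s\<in>S. c s \<odot>\<^bsub>A\<^esub> r s) \<in> \<I> 2" by blast
    have "(\<lambda>s. c s \<odot>\<^bsub>A\<^esub> r s) \<in> e ` {0..<card S} \<rightarrow> carrier A"
      unfolding eS(1) using c(1) S(2) mem_aug_ideal by (intro funcsetI smult_closed) auto
    from M.finsum_reindex[OF this eS(2)]
    have "(\<Oplus>\<^bsub>A\<^esub>s\<in>S. c s \<odot>\<^bsub>A\<^esub> r s) = (\<Oplus>\<^bsub>A\<^esub>x\<in>{0..<card S}. c (e x) \<odot>\<^bsub>A\<^esub> r (e x))"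
      unfolding eS(1) .
    with c mem show "\<exists>c\<in>{0..<card S} \<rightarrow> carrier k.
        j \<ominus>\<^bsub>A\<^esub> (\<Oplus>\<^bsub>A\<^esub>x\<in>{0..<card S}. c x \<odot>\<^bsub>A\<^esub> (r \<circ> e) x) \<in> \<I> 2"
      by (intro bexI[of _ "\<lambda>x. c (e x)"]) auto
  qed simp
qed

end

theorem theorem1p12:
  fixes k :: "('k, 'm) ring_scheme"
    and A :: "('k, 'a, 'n) aug_algebra_scheme"
  assumes "cring k"
    and "augmented_algebra k A"
    and "finite_type k A"
  shows "complete_aug_algebra k A \<longleftrightarrow>
    (\<exists>(X :: nat set) J. finite X \<and>
      closed_ideal k (nc_power_series k X) J \<and>
      J \<subseteq> aug_ideal k (nc_power_series k X) \<and>
      aug_isomorphic k A (quot_aug_algebra (nc_power_series k X) J))"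
proof -
  interpret A: augmented_algebra k A by fact
  show ?thesis
  proof
    assume "complete_aug_algebra k A"
    then have sep: "A.adic_separated" and complete: "A.adic_cauchy_complete"
      by (simp_all add: A.complete_iff)
    obtain X y where X: "finite (X :: nat set)" and y: "\<And>x. x \<in> X \<Longrightarrow> y x \<in> aug_ideal k A"
      and gen: "\<And>j. j \<in> aug_ideal k A \<Longrightarrow>
        \<exists>c\<in>X \<rightarrow> carrier k. j \<ominus>\<^bsub>A\<^esub> (\<Oplus>\<^bsub>A\<^esub>x\<in>X. c x \<odot>\<^bsub>A\<^esub> y x) \<in> A.aug_power 2"
      by (rule A.finite_type_generators_nat[OF assms(3)]) (rule that)
    interpret E: series_evaluation k X A y
      by unfold_locales (use X y in auto)
    obtain \<phi> where hom: "aug_algebra_hom k E.S.P A \<phi>"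
      and \<phi>: "\<And>f n. f \<in> carrier E.S.P \<Longrightarrow> \<phi> f \<ominus>\<^bsub>A\<^esub> E.eval_below n f \<in> A.aug_power n"
      by (rule E.evaluation_aug_hom[OF sep complete]) (rule that)
    interpret \<phi>: aug_algebra_hom k E.S.P A \<phi> by (rule hom)
    interpret J: ideal "A.aug_power 2" A by (rule A.ideal_aug_power)
    \<comment> \<open>Linear forms provide the approximate preimages: modulo \<open>I^2\<close> the
      value of a form is its truncation at 2, the combination of the \<open>y x\<close> with the
      same coefficients.\<close>
    have "\<exists>g\<in>aug_ideal k E.S.P. j \<ominus>\<^bsub>A\<^esub> \<phi> g \<in> A.aug_power 2" if j: "j \<in> aug_ideal k A" for j
    proof -
      from gen[OF j] obtain c where c: "c \<in> X \<rightarrow> carrier k"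
        and jc: "j \<ominus>\<^bsub>A\<^esub> E.eval_below 2 (E.linear_form c) \<in> A.aug_power 2"
        using E.eval_below_linear_form by force
      let ?g = "E.linear_form c"
      have g: "?g \<in> aug_ideal k E.S.P" by (rule E.linear_form_mem[OF c])
      then have gP: "?g \<in> carrier E.S.P" by (simp add: E.S.mem_aug_ideal_series)
      have "j \<in> carrier A" using j by (simp add: A.mem_aug_ideal)
      moreover have "E.eval_below 2 ?g \<ominus>\<^bsub>A\<^esub> \<phi> ?g \<in> A.aug_power 2"
        by (rule J.diff_sym[OF _ _ \<phi>[OF gP]]) (simp_all add: gP)
      ultimately have "j \<ominus>\<^bsub>A\<^esub> \<phi> ?g \<in> A.aug_power 2"
        using J.diff_trans[OF _ _ _ jc] gP by simp
      with g show ?thesis by blast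
    qed
    then have surj: "\<phi> ` carrier E.S.P = carrier A"
      by (rule \<phi>.surj_of_generating[OF _ sep E.S.adic_cauchy_complete_series[OF X]])
    show "\<exists>(X :: nat set) J. finite X \<and> closed_ideal k (nc_power_series k X) J \<and>
      J \<subseteq> aug_ideal k (nc_power_series k X) \<and>
      aug_isomorphic k A (quot_aug_algebra (nc_power_series k X) J)"
      using X \<phi>.closed_kernel[OF sep] \<phi>.kernel_subset_aug_ideal \<phi>.aug_isomorphic_quot_kernel[OF surj]
      by blast
  next
    assume "\<exists>(X :: nat set) J. finite X \<and> closed_ideal k (nc_power_series k X) J \<and>
      J \<subseteq> aug_ideal k (nc_power_series k X) \<and>
      aug_isomorphic k A (quot_aug_algebra (nc_power_series k X) J)"
    then obtain X :: "nat set" and J where X: "finite X"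
      and closed: "closed_ideal k (nc_power_series k X) J"
      and J: "J \<subseteq> aug_ideal k (nc_power_series k X)"
      and iso: "aug_isomorphic k A (quot_aug_algebra (nc_power_series k X) J)" by blast
    interpret S: nc_series k X using assms(1) by (rule nc_series.intro)
    have "ideal J S.P" using closed by (simp add: closed_ideal_def)
    \<comment> \<open>With a surjection from the series algebra at hand, separatedness and
      convergence are two separate transfer statements, and only the former uses that the kernel
      \<open>J\<close> is closed.\<close>
    from aug_isomorphic_quotE[OF assms(2) S.P.augmented_algebra_axioms this J iso]
    obtain \<phi> where hom: "aug_algebra_hom k S.P A \<phi>"
      and surj: "\<phi> ` carrier S.P = carrier A" and ker: "a_kernel S.P A \<phi> = J" by blast
    interpret \<phi>: aug_algebra_hom k S.P A \<phi> by (rule hom)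
    show "complete_aug_algebra k A"
      unfolding A.complete_iff
      using \<phi>.adic_separated_of_closed_kernel[OF surj] closed ker
        \<phi>.adic_cauchy_complete_of_surj[OF surj S.adic_cauchy_complete_series[OF X]] by simp
  qed
qed

end
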